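(* (Discrete Concentration-Compactness lemma) Let $N\ge3$ be an integer, $1\le p<N$, $p^{\ast}=\frac{Np}{N-p}$, $q\ge p^{\ast}$, and let $$S:=\inf\left\{\|u\|_{D^{1,p}}^{p} : u\in D^{1,p}(\mathbb{Z}^N),\ \|u\|_{q}=1\right\}.$$ Let $\{u_n\}$ be uniformly bounded in $D^{1,p}(\mathbb{Z}^N)$. Then, after passing to a subsequence (still denoted $\{u_n\}$), there is a function $u$ on $\mathbb{Z}^N$ such that $$u_n\to u\ \text{ pointwise in }\mathbb{Z}^N,\qquad |\nabla u_n|_p^p\overset{w^{\ast}}{\rightharpoonup}|\nabla u|_p^p\ \text{ in }\ell^1(\mathbb{Z}^N),$$ and the limits $$\mu_\infty:=\lim_{R\to\infty}\lim_{n\to\infty}\sum_{d(i,0)>R}|\nabla u_n(i)|_p^p,\qquad \nu_\infty:=\lim_{R\to\infty}\lim_{n\to\infty}\sum_{d(i,0)>R}|u_n(i)|^q$$ exist. For this subsequence one has: $$|\nabla(u_n-u)|_p^p\overset{w^{\ast}}{\rightharpoonup}0\ \text{ in }\ell^1(\mathbb{Z}^N),\qquad |u_n-u|^q\overset{w^{\ast}}{\rightharpoonup}0\ \text{ in }\ell^1(\mathbb{Z}^N),$$ $$\nu_\infty^{p/q}\le S^{-1}\mu_\infty,$$ $$\lim_{n\to\infty}\|u_n\|_{D^{1,p}}^p=\|u\|_{D^{1,p}}^p+\mu_\infty,\qquad \lim_{n\to\infty}\|u_n\|_q^q=\|u\|_q^q+\nu_\infty.$$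
   Context: $\mathbb{Z}^N$ is the integer lattice graph: $x\sim y$ iff $\sum_{k=1}^N|x_k-y_k|=1$; $d$ is the combinatorial (graph) distance. Functions are real-valued. $\|u\|_q=\left(\sum_{x}|u(x)|^q\right)^{1/q}$. For a function $u$ on $\mathbb{Z}^N$, $$|\nabla u(x)|_p:=\left(\sum_{y\sim x}|u(y)-u(x)|^p\right)^{1/p},\qquad \|u\|_{D^{1,p}}:=\left(\sum_{x\in\mathbb{Z}^N}|\nabla u(x)|_p^p\right)^{1/p}.$$ $D^{1,p}(\mathbb{Z}^N)$ is the completion of the space $C_0(\mathbb{Z}^N)$ of finitely supported functions in the $D^{1,p}$ norm, regarded as a space of functions on $\mathbb{Z}^N$: those $u$ for which there are $\varphi_k\in C_0(\mathbb{Z}^N)$ with $\varphi_k\to u$ pointwise and $\|\varphi_k-u\|_{D^{1,p}}\to0$. By the (known) discrete Sobolev inequality, $\|u\|_q\le C_{p,q}\|u\|_{D^{1,p}}$ on $D^{1,p}(\mathbb{Z}^N)$ for $q\ge p^{\ast}$, so $S>0$. Let $c_0(\mathbb{Z}^N)$ be the completion of $C_0(\mathbb{Z}^N)$ in the $\ell^\infty$ norm, so $\ell^1(\mathbb{Z}^N)=(c_0(\mathbb{Z}^N))^{\ast}$; $\mu_n\overset{w^{\ast}}{\rightharpoonup}\mu$ in $\ell^1(\mathbb{Z}^N)$ means $\sum_x\mu_n(x)h(x)\to\sum_x\mu(x)h(x)$ for every $h\in c_0(\mathbb{Z}^N)$. *)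

theory Defs
  imports "HOL-Analysis.Analysis"
begin

text \<open>The lattice graph on the type \<open>int ^ 'n\<close>; its dimension is \<open>CARD('n)\<close>.\<close>

definition lattice_adj :: "int ^ 'n \<Rightarrow> int ^ 'n \<Rightarrow> bool" where
  "lattice_adj x y \<longleftrightarrow> (\<Sum>k\<in>UNIV. \<bar>x $ k - y $ k\<bar>) = 1"

text \<open>Length of a shortest path; the lattice is connected, so the minimum is attained.\<close>

definition lattice_dist :: "int ^ 'n \<Rightarrow> int ^ 'n \<Rightarrow> nat" where
  "lattice_dist x y = (LEAST m. (x, y) \<in> {(a, b). lattice_adj a b} ^^ m)"

text \<open>
  \<open>infsum\<close> returns 0 on families that are not summable, so a real-valued norm below is the
  intended one only for functions of finite norm. Finiteness is therefore always stated
  separately: by membership in \<open>ell q\<close>, and by the summability clause in \<open>D1\<close>.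
\<close>

definition ell :: "real \<Rightarrow> ('a \<Rightarrow> real) set" where
  "ell q = {u. (\<lambda>x. \<bar>u x\<bar> powr q) summable_on UNIV}"

definition ell_norm :: "real \<Rightarrow> ('a \<Rightarrow> real) \<Rightarrow> real" where
  "ell_norm q u = (\<Sum>\<^sub>\<infinity>x. \<bar>u x\<bar> powr q) powr (1 / q)"

definition grad_norm :: "real \<Rightarrow> (int ^ 'n \<Rightarrow> real) \<Rightarrow> int ^ 'n \<Rightarrow> real" where
  "grad_norm p u x = (\<Sum>y\<in>{y. lattice_adj x y}. \<bar>u y - u x\<bar> powr p) powr (1 / p)"

definition D1_norm :: "real \<Rightarrow> (int ^ 'n \<Rightarrow> real) \<Rightarrow> real" where
  "D1_norm p u = (\<Sum>\<^sub>\<infinity>x. grad_norm p u x powr p) powr (1 / p)"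

definition finitely_supported :: "('a \<Rightarrow> real) set" where
  "finitely_supported = {\<phi>. finite {x. \<phi> x \<noteq> 0}}"

definition D1 :: "real \<Rightarrow> (int ^ 'n \<Rightarrow> real) set" where
  "D1 p = {u. \<exists>\<phi> :: nat \<Rightarrow> int ^ 'n \<Rightarrow> real.
      (\<forall>k. \<phi> k \<in> finitely_supported) \<and>
      (\<forall>x. (\<lambda>k. \<phi> k x) \<longlonglongrightarrow> u x) \<and>
      (\<forall>k. (\<lambda>x. grad_norm p (\<lambda>y. \<phi> k y - u y) x powr p) summable_on UNIV) \<and>
      (\<lambda>k. D1_norm p (\<lambda>y. \<phi> k y - u y)) \<longlonglongrightarrow> 0}"

text \<open>The completion of the finitely supported functions in the supremum norm.\<close>

definition c0 :: "('a \<Rightarrow> real) set" where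
  "c0 = {h. \<exists>\<phi> :: nat \<Rightarrow> 'a \<Rightarrow> real.
      (\<forall>k. \<phi> k \<in> finitely_supported) \<and> uniform_limit UNIV \<phi> h sequentially}"

definition weak_star_ell1 :: "(nat \<Rightarrow> 'a \<Rightarrow> real) \<Rightarrow> ('a \<Rightarrow> real) \<Rightarrow> bool" where
  "weak_star_ell1 \<mu> \<mu>' \<longleftrightarrow> (\<forall>n. \<mu> n \<in> ell 1) \<and> \<mu>' \<in> ell 1 \<and>
      (\<forall>h\<in>c0. (\<lambda>n. \<Sum>\<^sub>\<infinity>x. \<mu> n x * h x) \<longlonglongrightarrow> (\<Sum>\<^sub>\<infinity>x. \<mu>' x * h x))"

text \<open>
  \<open>tail_limit f L\<close>: the iterated limit, first in \<open>n\<close> and then in \<open>R\<close>, of the sums of \<open>f n\<close>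
  over the points at distance greater than \<open>R\<close> from the origin exists and equals \<open>L\<close>.
  The function \<open>T\<close> gives the inner limits.
\<close>

definition tail_limit :: "(nat \<Rightarrow> int ^ 'n \<Rightarrow> real) \<Rightarrow> real \<Rightarrow> bool" where
  "tail_limit f L \<longleftrightarrow> (\<exists>T :: real \<Rightarrow> real.
      (\<forall>R. (\<lambda>n. \<Sum>\<^sub>\<infinity>i\<in>{i. real (lattice_dist i 0) > R}. f n i) \<longlonglongrightarrow> T R) \<and>
      (T \<longlongrightarrow> L) at_top)"

end

theory Submission
  imports Defs "HOL-Complex_Analysis.Great_Picard"
begin

text \<open>
  Two facts carry the proof: the discrete Sobolev inequality, and the splitting of Brezis and
  Lieb, by which the mass that a pointwise limit loses is the mass of the difference.

  \<^emph>\<open>Sobolev.\<close> For \<open>p = 1\<close> and finite support, \<open>\<bar>u x\<bar>\<close> is at most the total variation of \<open>u\<close> on the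
  line through \<open>x\<close> in direction \<open>i\<close>, for each of the \<open>N\<close> directions, and this bound does not depend
  on the coordinate \<open>i\<close> of \<open>x\<close>. The inequality of Gagliardo (\<open>gagliardo_inequality\<close>) combines the
  \<open>N\<close> bounds into the exponent \<open>N / (N - 1)\<close>. For \<open>p > 1\<close> this is applied to a power of \<open>\<bar>u\<bar>\<close>, and
  Hoelder's inequality does the rest (\<open>discrete_sobolev_critical\<close>). Larger \<open>q\<close> follow from the
  inclusions between the \<open>\<ell>\<close> spaces, and all of \<open>D1 p\<close> by Fatou's lemma.

  \<^emph>\<open>Membership in \<open>D1 p\<close>.\<close> Conversely, a function in \<open>\<ell>\<^sup>q\<close> whose gradient is \<open>p\<close>-summable lies in
  \<open>D1 p\<close> (\<open>D1_I\<close>): remove from it its truncation to \<open>[- \<epsilon>, \<epsilon>]\<close>. What remains has finite support,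
  and the gradient of the truncation is dominated by that of the function and tends to \<open>0\<close> with \<open>\<epsilon>\<close>.
  Hence the differences \<open>v n - u\<close> below are admissible in the variational problem that defines \<open>S\<close>.

  \<^emph>\<open>Conclusion.\<close> Take a subsequence along which \<open>v n\<close> converges pointwise to \<open>u\<close> and both total masses,
  the \<open>p\<close>-th power of the gradient norm and the \<open>q\<close>-th power of the \<open>\<ell>\<^sup>q\<close> norm, converge. Let \<open>\<mu>\<close> and \<open>\<nu>\<close>
  be the limits of these masses minus the masses of \<open>u\<close>. Since balls are finite, the mass in a ball
  converges to that of \<open>u\<close>, so \<open>\<mu>\<close> and \<open>\<nu>\<close> are the iterated tail limits, and the two identities for
  the limits of the masses hold. The weak-star convergences hold because a sequence of
  nonnegative functions of bounded mass converges weak-star as soon as it converges pointwise.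
  By the splitting (\<open>brezis_lieb_infsum\<close>), the masses of \<open>v n - u\<close> converge to \<open>\<mu>\<close> and \<open>\<nu>\<close>. Passing to the
  limit in the Sobolev inequality with constant \<open>S\<close> for \<open>v n - u\<close> gives the estimate of \<open>\<nu>\<close> by \<open>\<mu>\<close>.
\<close>

section \<open>Hoelder's inequality for finite sums\<close>

text \<open>
  Dividing every \<open>f i\<close> by its sum over \<open>T\<close> reduces the claim to the inequality between the
  geometric and the arithmetic mean, summed over \<open>T\<close>.
\<close>

lemma generalized_holder_sum:
  fixes f :: "'i \<Rightarrow> 'a \<Rightarrow> real"
  assumes I: "finite I" "I \<noteq> {}" and T: "finite T"
    and f0: "\<And>i t. i \<in> I \<Longrightarrow> t \<in> T \<Longrightarrow> f i t \<ge> 0"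
  shows "(\<Sum>t\<in>T. \<Prod>i\<in>I. f i t powr (1 / card I)) \<le> (\<Prod>i\<in>I. (\<Sum>t\<in>T. f i t) powr (1 / card I))"
proof (cases "\<exists>i\<in>I. (\<Sum>t\<in>T. f i t) = 0")
  case True
  then obtain i where i: "i \<in> I" "(\<Sum>t\<in>T. f i t) = 0" by blast
  then have "f i t = 0" if "t \<in> T" for t
    using sum_nonneg_eq_0_iff[OF T, of "f i"] f0 that by blast
  then have "(\<Prod>i\<in>I. f i t powr (1 / card I)) = 0" if "t \<in> T" for t
    using I i that by (auto intro!: prod_zero bexI[of _ i])
  then show ?thesis
    by (simp add: prod_nonneg)
next
  case False
  define s where "s i = (\<Sum>t\<in>T. f i t)" for i
  have s0: "s i > 0" if "i \<in> I" for i
    using False that sum_nonneg[of T "f i"] f0 by (force simp: s_def less_le)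
  define P where "P = (\<Prod>i\<in>I. s i powr (1 / card I))"
  have "P > 0" unfolding P_def by (intro prod_pos ballI) (metis s0 powr_gt_zero less_irrefl)
  have "(\<Sum>t\<in>T. \<Prod>i\<in>I. f i t powr (1 / card I)) = (\<Sum>t\<in>T. P * (\<Prod>i\<in>I. f i t / s i) powr (1 / card I))"
  proof (rule sum.cong)
    fix t assume "t \<in> T"
    have "(\<Prod>i\<in>I. f i t powr (1 / card I)) = (\<Prod>i\<in>I. s i powr (1 / card I) * (f i t / s i) powr (1 / card I))"
    proof (rule prod.cong)
      fix i assume "i \<in> I"
      then have "s i \<noteq> 0" using s0 by fastforce
      then show "f i t powr (1 / card I) = s i powr (1 / card I) * (f i t / s i) powr (1 / card I)"
        by (simp flip: powr_mult)
    qed simp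
    then show "(\<Prod>i\<in>I. f i t powr (1 / card I)) = P * (\<Prod>i\<in>I. f i t / s i) powr (1 / card I)"
      by (simp add: prod.distrib P_def prod_powr_distrib)
  qed simp
  also have "\<dots> \<le> (\<Sum>t\<in>T. P * (\<Sum>i\<in>I. f i t / s i / card I))"
    using I f0 s0 \<open>P > 0\<close>
    by (intro sum_mono mult_left_mono arith_geom_mean) (auto intro!: divide_nonneg_pos)
  also have "\<dots> = P * (\<Sum>i\<in>I. (\<Sum>t\<in>T. f i t) / s i / card I)"
    by (simp add: sum.swap[of _ T] sum_divide_distrib flip: sum_distrib_left)
  also have "(\<Sum>i\<in>I. (\<Sum>t\<in>T. f i t) / s i / card I) = (\<Sum>i\<in>I. 1 / card I)"
    using s0 by (intro sum.cong) (auto simp: less_le simp flip: s_def)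
  also have "\<dots> = 1" using I by simp
  finally show ?thesis by (simp add: P_def s_def)
qed

text \<open>
  The first factor is written as a power of \<open>m\<close> instead of with the dual exponent of \<open>p\<close>, so
  that \<open>p = 1\<close> is covered: there \<open>m t powr 0\<close> is \<open>1\<close> or \<open>0\<close> according to whether \<open>m t\<close> vanishes.
  The proof is Young's inequality for the two factors, normalised by their total sums.
\<close>

lemma holder_sum_weighted:
  fixes m b :: "'a \<Rightarrow> real"
  assumes p: "p \<ge> 1" and m0: "\<And>t. t \<in> T \<Longrightarrow> m t \<ge> 0" and b0: "\<And>t. t \<in> T \<Longrightarrow> b t \<ge> 0"
  shows "(\<Sum>t\<in>T. m t powr (1 - 1 / p) * b t) \<le> (\<Sum>t\<in>T. m t) powr (1 - 1 / p) * (\<Sum>t\<in>T. b t powr p) powr (1 / p)"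
proof (cases "finite T")
  case T: True
  define X where "X = (\<Sum>t\<in>T. m t)"
  define Y where "Y = (\<Sum>t\<in>T. b t powr p)"
  have X0: "X \<ge> 0" and Y0: "Y \<ge> 0"
    using m0 by (auto simp: X_def Y_def intro!: sum_nonneg)
  show ?thesis
  proof (cases "X = 0 \<or> Y = 0")
    case True
    then have "m t powr (1 - 1 / p) * b t = 0" if "t \<in> T" for t
      using sum_nonneg_eq_0_iff[OF T, of m] sum_nonneg_eq_0_iff[OF T, of "\<lambda>t. b t powr p"] m0 that
      by (auto simp: X_def Y_def)
    then have "(\<Sum>t\<in>T. m t powr (1 - 1 / p) * b t) = 0"
      by (rule sum.neutral[rule_format])
    then show ?thesis by simp
  next
    case False
    with X0 Y0 have X: "X > 0" and Y: "Y > 0" by auto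
    have young: "m t powr (1 - 1 / p) * b t
        \<le> X powr (1 - 1 / p) * Y powr (1 / p) * ((1 - 1 / p) * (m t / X) + (1 / p) * (b t powr p / Y))"
      if t: "t \<in> T" for t
    proof (cases "m t = 0 \<or> b t = 0")
      case True
      then show ?thesis
        using m0[OF t] b0[OF t] X Y p by auto
    next
      case False
      then have mb: "m t > 0" "b t > 0" using m0[OF t] b0[OF t] by auto
      have "m t powr (1 - 1 / p) * b t
          = X powr (1 - 1 / p) * Y powr (1 / p) * ((m t / X) powr (1 - 1 / p) * (b t powr p / Y) powr (1 / p))"
        using mb X Y p by (simp add: powr_divide powr_powr)
      also have "(m t / X) powr (1 - 1 / p) * (b t powr p / Y) powr (1 / p)
          \<le> (1 - 1 / p) * (m t / X) + (1 / p) * (b t powr p / Y)"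
        using mb X Y p by (intro Youngs_inequality_0) auto
      finally show ?thesis
        using X Y by (simp add: mult_left_mono)
    qed
    have "(\<Sum>t\<in>T. m t powr (1 - 1 / p) * b t)
        \<le> (\<Sum>t\<in>T. X powr (1 - 1 / p) * Y powr (1 / p) * ((1 - 1 / p) * (m t / X) + (1 / p) * (b t powr p / Y)))"
      by (intro sum_mono young)
    also have "\<dots> = X powr (1 - 1 / p) * Y powr (1 / p) * ((1 - 1 / p) * ((\<Sum>t\<in>T. m t) / X) + (1 / p) * ((\<Sum>t\<in>T. b t powr p) / Y))"
      by (simp add: sum.distrib flip: sum_distrib_left sum_divide_distrib)
    also have "\<dots> = X powr (1 - 1 / p) * Y powr (1 / p)"
      using X Y by (simp flip: X_def Y_def)
    finally show ?thesis by (simp add: X_def Y_def)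
  qed
qed simp

section \<open>Summing over one coordinate at a time\<close>

definition vec_upd :: "'a ^ 'n \<Rightarrow> 'n \<Rightarrow> 'a \<Rightarrow> 'a ^ 'n" where
  "vec_upd x i t = (\<chi> k. if k = i then t else x $ k)"

lemma vec_upd_nth [simp]: "vec_upd x i t $ k = (if k = i then t else x $ k)"
  by (simp add: vec_upd_def)

lemma vec_upd_vec_upd [simp]: "vec_upd (vec_upd z i s) i t = vec_upd z i t"
  and vec_upd_same [simp]: "vec_upd z i (z $ i) = z"
  by (simp_all add: vec_eq_iff)

text \<open>
  The points that run through \<open>K\<close> in the coordinates \<open>J\<close> and agree with \<open>x\<close> in the others. A sum
  over a slab is an iterated sum over the coordinates in \<open>J\<close>; this allows induction over
  coordinates although the dimension is given by a type.
\<close>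

definition slab :: "'a set \<Rightarrow> 'n set \<Rightarrow> 'a ^ 'n \<Rightarrow> ('a ^ 'n) set" where
  "slab K J x = {z. (\<forall>i\<in>J. z $ i \<in> K) \<and> (\<forall>i. i \<notin> J \<longrightarrow> z $ i = x $ i)}"

lemma slab_empty [simp]: "slab K {} x = {x}"
  by (auto simp: slab_def vec_eq_iff)

lemma finite_coordinate_box:
  fixes A :: "'n::finite \<Rightarrow> 'a set"
  assumes "\<And>i. finite (A i)"
  shows "finite {z :: 'a ^ 'n. \<forall>i. z $ i \<in> A i}" and "card {z :: 'a ^ 'n. \<forall>i. z $ i \<in> A i} = (\<Prod>i\<in>UNIV. card (A i))"
proof -
  have eq: "{z :: 'a ^ 'n. \<forall>i. z $ i \<in> A i} = vec_lambda ` (PiE UNIV A)"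
  proof (intro equalityI subsetI)
    fix z :: "'a ^ 'n" assume "z \<in> {z. \<forall>i. z $ i \<in> A i}"
    then show "z \<in> vec_lambda ` (PiE UNIV A)"
      by (intro image_eqI[of _ _ "vec_nth z"]) auto
  qed auto
  show "finite {z :: 'a ^ 'n. \<forall>i. z $ i \<in> A i}"
    unfolding eq using assms by (intro finite_imageI finite_PiE) auto
  have "inj_on vec_lambda (PiE UNIV A)"
    by (auto simp: inj_on_def vec_lambda_inject)
  then show "card {z :: 'a ^ 'n. \<forall>i. z $ i \<in> A i} = (\<Prod>i\<in>UNIV. card (A i))"
    unfolding eq by (simp add: card_image card_PiE)
qed

lemma finite_slab:
  fixes x :: "'a ^ 'n::finite"
  assumes "finite K"
  shows "finite (slab K J x)"
proof -
  have "slab K J x = {z. \<forall>i. z $ i \<in> (if i \<in> J then K else {x $ i})}"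
    by (auto simp: slab_def split: if_splits)
  then show ?thesis
    using assms by (simp add: finite_coordinate_box(1))
qed

lemma sum_slab_vec_upd:
  fixes x :: "'a ^ 'n::finite"
  assumes "j \<notin> J"
  shows "(\<Sum>z\<in>slab K J (vec_upd x j t). F z) = (\<Sum>z\<in>slab K J x. F (vec_upd z j t))"
  by (rule sum.reindex_bij_witness[of _ "\<lambda>z. vec_upd z j t" "\<lambda>z. vec_upd z j (x $ j)"])
    (use assms in \<open>auto simp: slab_def vec_eq_iff intro!: arg_cong[of _ _ F]\<close>)

text \<open>
  Fubini: the added coordinate becomes the outer sum.
\<close>

lemma sum_slab_insert:
  fixes x :: "'a ^ 'n::finite"
  assumes "j \<notin> J" "finite K"
  shows "(\<Sum>z\<in>slab K (insert j J) x. F z) = (\<Sum>t\<in>K. \<Sum>z\<in>slab K J (vec_upd x j t). F z)"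
proof -
  have "slab K (insert j J) x = (\<Union>t\<in>K. slab K J (vec_upd x j t))"
  proof (intro equalityI subsetI)
    fix z assume "z \<in> slab K (insert j J) x"
    then show "z \<in> (\<Union>t\<in>K. slab K J (vec_upd x j t))"
      by (intro UN_I[of "z $ j"]) (auto simp: slab_def)
  qed (use assms in \<open>auto simp: slab_def split: if_splits\<close>)
  moreover have "slab K J (vec_upd x j t) \<inter> slab K J (vec_upd x j t') = {}" if "t \<noteq> t'" for t t'
  proof -
    have "z $ j = s" if "z \<in> slab K J (vec_upd x j s)" for z s
      using that assms by (simp add: slab_def)
    then show ?thesis using that by blast
  qed
  ultimately show ?thesis
    using assms by (simp add: sum.UNION_disjoint finite_slab)
qed

text \<open>
  The case of interest is \<open>J = UNIV\<close>; arbitrary \<open>J\<close> make an induction possible that sums over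
  one more coordinate \<open>j\<close> in each step. The factor that belongs to \<open>g j\<close> is constant in this
  coordinate and leaves the sum. The other \<open>N - 1\<close> factors have the exponent \<open>1 / (N - 1)\<close> each,
  so that Hoelder's inequality for \<open>N - 1\<close> functions applies to them.
\<close>

lemma gagliardo_inequality:
  fixes g :: "'n::finite \<Rightarrow> 'a ^ 'n \<Rightarrow> real"
  assumes N: "CARD('n) \<ge> 2" and K: "finite K"
    and g0: "\<And>i z. g i z \<ge> 0" and indep: "\<And>i z t. g i (vec_upd z i t) = g i z"
  defines "\<alpha> \<equiv> 1 / (real CARD('n) - 1)"
  shows "(\<Sum>z\<in>slab K J x. \<Prod>i\<in>UNIV. g i z powr \<alpha>) \<le> (\<Prod>i\<in>UNIV. (\<Sum>z\<in>slab K (J - {i}) x. g i z) powr \<alpha>)"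
proof -
  have "finite J" by simp
  then show ?thesis
  proof (induction J arbitrary: x)
    case empty
    show ?case by simp
  next
    case (insert j J)
    define \<sigma> where "\<sigma> i L y = (\<Sum>z\<in>slab K L y. g i z)" for i L y
    have \<sigma>0: "\<sigma> i L y \<ge> 0" for i L y
      by (simp add: \<sigma>_def sum_nonneg g0)
    have \<alpha>: "\<alpha> = 1 / card (UNIV - {j})"
      using N by (simp add: \<alpha>_def card_Diff_singleton of_nat_diff)
    have ne: "UNIV - {j} \<noteq> {}"
    proof
      assume "UNIV - {j} = {}"
      then have "card (UNIV :: 'n set) \<le> card {j}" by (intro card_mono) auto
      then show False using N by simp
    qed
    have "(\<Sum>z\<in>slab K (insert j J) x. \<Prod>i\<in>UNIV. g i z powr \<alpha>)
        = (\<Sum>t\<in>K. \<Sum>z\<in>slab K J (vec_upd x j t). \<Prod>i\<in>UNIV. g i z powr \<alpha>)"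
      by (rule sum_slab_insert[OF insert.hyps(2) K])
    also have "\<dots> \<le> (\<Sum>t\<in>K. \<Prod>i\<in>UNIV. \<sigma> i (J - {i}) (vec_upd x j t) powr \<alpha>)"
      unfolding \<sigma>_def by (intro sum_mono insert.IH)
    also have "\<dots> = (\<Sum>t\<in>K. \<sigma> j J x powr \<alpha> * (\<Prod>i\<in>UNIV - {j}. \<sigma> i (J - {i}) (vec_upd x j t) powr \<alpha>))"
    proof (rule sum.cong)
      fix t assume "t \<in> K"
      have "\<sigma> j (J - {j}) (vec_upd x j t) = \<sigma> j J x"
        using insert.hyps by (simp add: \<sigma>_def sum_slab_vec_upd indep)
      then show "(\<Prod>i\<in>UNIV. \<sigma> i (J - {i}) (vec_upd x j t) powr \<alpha>)
          = \<sigma> j J x powr \<alpha> * (\<Prod>i\<in>UNIV - {j}. \<sigma> i (J - {i}) (vec_upd x j t) powr \<alpha>)"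
        by (simp add: prod.remove[of UNIV j])
    qed simp
    also have "\<dots> = \<sigma> j J x powr \<alpha> * (\<Sum>t\<in>K. \<Prod>i\<in>UNIV - {j}. \<sigma> i (J - {i}) (vec_upd x j t) powr \<alpha>)"
      by (simp add: sum_distrib_left)
    also have "\<dots> \<le> \<sigma> j J x powr \<alpha> * (\<Prod>i\<in>UNIV - {j}. (\<Sum>t\<in>K. \<sigma> i (J - {i}) (vec_upd x j t)) powr \<alpha>)"
      unfolding \<alpha> using ne K \<sigma>0 by (intro mult_left_mono generalized_holder_sum) auto
    also have "\<dots> = \<sigma> j (insert j J - {j}) x powr \<alpha> * (\<Prod>i\<in>UNIV - {j}. \<sigma> i (insert j J - {i}) x powr \<alpha>)"
    proof -
      have "(\<Sum>t\<in>K. \<sigma> i (J - {i}) (vec_upd x j t)) = \<sigma> i (insert j J - {i}) x" if "i \<in> UNIV - {j}" for i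
      proof -
        have "insert j J - {i} = insert j (J - {i})" using that by auto
        then show ?thesis
          using insert.hyps(2) K by (simp add: \<sigma>_def sum_slab_insert)
      qed
      moreover have "insert j J - {j} = J" using insert.hyps by auto
      ultimately show ?thesis by simp
    qed
    also have "\<dots> = (\<Prod>i\<in>UNIV. \<sigma> i (insert j J - {i}) x powr \<alpha>)"
      by (simp add: prod.remove[of UNIV j])
    finally show ?case by (simp add: \<sigma>_def)
  qed
qed

section \<open>The lattice graph\<close>

lemma lattice_adj_sym: "lattice_adj x y \<longleftrightarrow> lattice_adj y x"
  by (simp add: lattice_adj_def abs_minus_commute)

lemma lattice_adj_coordinate:
  assumes "lattice_adj x y"
  shows "y $ k \<in> {x $ k - 1..x $ k + 1}"
proof -
  have "\<bar>x $ k - y $ k\<bar> \<le> (\<Sum>k\<in>UNIV. \<bar>x $ k - y $ k\<bar>)"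
    by (rule member_le_sum) auto
  then show ?thesis
    using assms by (auto simp: lattice_adj_def)
qed

lemma finite_nbrs [simp]: "finite {y. lattice_adj x y}"
  and card_nbrs_le: "card {y. lattice_adj x y} \<le> 3 ^ CARD('n)"
  for x :: "int ^ 'n"
proof -
  define A where "A = {y :: int ^ 'n. \<forall>k. y $ k \<in> {x $ k - 1..x $ k + 1}}"
  have sub: "{y. lattice_adj x y} \<subseteq> A"
    using lattice_adj_coordinate by (auto simp: A_def)
  have fin: "finite A" and card: "card A = 3 ^ CARD('n)"
    unfolding A_def by (simp_all add: finite_coordinate_box del: atLeastAtMost_iff)
  show "finite {y. lattice_adj x y}" "card {y. lattice_adj x y} \<le> 3 ^ CARD('n)"
    using finite_subset[OF sub fin] card_mono[OF fin sub] card by simp_all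
qed

lemma sum_abs_diff_vec_upd:
  fixes x :: "int ^ 'n"
  shows "(\<Sum>k\<in>UNIV. \<bar>x $ k - vec_upd x i t $ k\<bar>) = \<bar>x $ i - t\<bar>"
proof -
  have "(\<Sum>k\<in>UNIV. \<bar>x $ k - vec_upd x i t $ k\<bar>) = (\<Sum>k\<in>UNIV. if k = i then \<bar>x $ i - t\<bar> else 0)"
    by (intro sum.cong) auto
  then show ?thesis by simp
qed

lemma lattice_adj_vec_upd: "\<bar>x $ i - t\<bar> = 1 \<Longrightarrow> lattice_adj x (vec_upd x i t)"
  unfolding lattice_adj_def by (simp only: sum_abs_diff_vec_upd)

text \<open>
  A step that moves a nonzero coordinate towards \<open>0\<close> decreases the sum of the absolute values of
  the coordinates. It follows that the least length in \<open>lattice_dist\<close> is attained.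
\<close>

lemma lattice_path_to_0: "\<exists>m. (x, 0) \<in> {(a, b). lattice_adj a b} ^^ m"
  for x :: "int ^ 'n"
proof (induction "nat (\<Sum>k\<in>UNIV. \<bar>x $ k\<bar>)" arbitrary: x rule: less_induct)
  case less
  show ?case
  proof (cases "x = 0")
    case True
    then show ?thesis by (intro exI[of _ 0]) simp
  next
    case False
    then obtain i where i: "x $ i \<noteq> 0" by (auto simp: vec_eq_iff)
    define y where "y = vec_upd x i (x $ i - sgn (x $ i))"
    have adj: "lattice_adj x y"
      unfolding y_def using i by (intro lattice_adj_vec_upd) (auto simp: sgn_if)
    have "(\<Sum>k\<in>UNIV. \<bar>y $ k\<bar>) < (\<Sum>k\<in>UNIV. \<bar>x $ k\<bar>)"
      by (rule sum_strict_mono_ex1) (use i in \<open>auto simp: y_def sgn_if intro!: bexI[of _ i]\<close>)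
    then have "nat (\<Sum>k\<in>UNIV. \<bar>y $ k\<bar>) < nat (\<Sum>k\<in>UNIV. \<bar>x $ k\<bar>)"
      using sum_nonneg[of UNIV "\<lambda>k. \<bar>y $ k\<bar>"] by linarith
    from less[OF this] obtain m where "(y, 0) \<in> {(a, b). lattice_adj a b} ^^ m" by blast
    then have "(x, 0) \<in> {(a, b). lattice_adj a b} ^^ Suc m"
      using adj by (intro relpow_Suc_I2[of _ y]) auto
    then show ?thesis by blast
  qed
qed

lemma lattice_path_coordinate_le:
  "(x, y) \<in> {(a, b). lattice_adj a b} ^^ m \<Longrightarrow> \<bar>x $ k - y $ k\<bar> \<le> int m"
proof (induction m arbitrary: y)
  case (Suc m)
  then obtain z where z: "(x, z) \<in> {(a, b). lattice_adj a b} ^^ m" "lattice_adj z y" by auto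
  show ?case
    using Suc.IH[OF z(1)] lattice_adj_coordinate[OF z(2), of k] by auto
qed auto

text \<open>
  A path of length \<open>m\<close> changes each coordinate by at most \<open>m\<close>, so the ball lies in a box.
\<close>

lemma finite_lattice_ball: "finite {i :: int ^ 'n. lattice_dist i 0 \<le> R}"
proof (rule finite_subset)
  show "{i :: int ^ 'n. lattice_dist i 0 \<le> R} \<subseteq> {z. \<forall>k. z $ k \<in> {- int R..int R}}"
  proof safe
    fix i :: "int ^ 'n" and k assume R: "lattice_dist i 0 \<le> R"
    have "(i, 0) \<in> {(a, b). lattice_adj a b} ^^ lattice_dist i 0"
      unfolding lattice_dist_def using lattice_path_to_0 by (rule LeastI_ex)
    from lattice_path_coordinate_le[OF this, of k] R show "i $ k \<in> {- int R..int R}" by auto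
  qed
qed (rule finite_coordinate_box, simp)

section \<open>The discrete Sobolev inequality for finite support\<close>

lemma grad_norm_powr:
  assumes "p \<noteq> 0"
  shows "grad_norm p u x powr p = (\<Sum>y\<in>{y. lattice_adj x y}. \<bar>u y - u x\<bar> powr p)"
  using assms by (simp add: grad_norm_def powr_powr sum_nonneg)

text \<open>
  Outside the neighbourhood of its support a function has zero gradient.
\<close>

definition nbhd :: "(int ^ 'n) set \<Rightarrow> (int ^ 'n) set" where
  "nbhd A = A \<union> (\<Union>x\<in>A. {y. lattice_adj x y})"

lemma finite_nbhd: "finite A \<Longrightarrow> finite (nbhd A)"
  by (simp add: nbhd_def)

lemma grad_norm_powr_has_sum:
  assumes "p \<noteq> 0" and fin: "finite {x. u x \<noteq> 0}"
  shows "((\<lambda>x. grad_norm p u x powr p) has_sum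
      (\<Sum>x\<in>nbhd {x. u x \<noteq> 0}. \<Sum>y\<in>{y. lattice_adj x y}. \<bar>u y - u x\<bar> powr p)) UNIV"
proof (rule has_sum_finite_neutralI[OF finite_nbhd[OF fin]])
  fix x assume x: "x \<in> UNIV - nbhd {x. u x \<noteq> 0}"
  have "u x = 0" "\<And>y. lattice_adj x y \<Longrightarrow> u y = 0"
    using x lattice_adj_sym by (auto simp: nbhd_def)
  then show "grad_norm p u x powr p = 0"
    using assms by (auto simp: grad_norm_powr intro!: sum.neutral)
qed (use assms in \<open>auto simp: grad_norm_powr\<close>)

lemma abs_le_sum_increments:
  fixes w :: "int \<Rightarrow> real"
  assumes "w a = 0" "t \<ge> a"
  shows "\<bar>w t\<bar> \<le> (\<Sum>s\<in>{a..<t}. \<bar>w (s + 1) - w s\<bar>)"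
  using \<open>t \<ge> a\<close>
proof (induction t rule: int_ge_induct)
  case base
  then show ?case using assms by simp
next
  case (step t)
  have "{a..<t + 1} = insert t {a..<t}" using step by auto
  then show ?case using step by simp
qed

lemma prod_const_powr:
  fixes a \<alpha> :: real
  shows "(\<Prod>i\<in>(UNIV :: 'n::finite set). a powr \<alpha>) = a powr (CARD('n) * \<alpha>)"
  by (cases "a = 0") (simp_all add: powr_power mult.commute)

text \<open>
  The function \<open>g i\<close> in the proof, the variation of \<open>w\<close> along lines in direction \<open>i\<close>, is
  independent of the coordinate \<open>i\<close> and bounds \<open>\<bar>w\<bar>\<close>. Its sum over the other coordinates is the
  sum of all increments of \<open>w\<close> in direction \<open>i\<close>, hence at most the total gradient.
\<close>

lemma gagliardo_nirenberg_1:
  fixes w :: "int ^ 'n \<Rightarrow> real"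
  assumes N: "CARD('n) \<ge> 2" and fin: "finite {x. w x \<noteq> 0}"
  shows "(\<Sum>x | w x \<noteq> 0. \<bar>w x\<bar> powr (CARD('n) / (real CARD('n) - 1)))
    \<le> (\<Sum>\<^sub>\<infinity>x. grad_norm 1 w x powr 1) powr (CARD('n) / (real CARD('n) - 1))"
proof -
  define \<alpha> where "\<alpha> = 1 / (real CARD('n) - 1)"
  define E where "E = (\<Sum>\<^sub>\<infinity>x. grad_norm 1 w x powr 1)"
  have \<alpha>0: "\<alpha> \<ge> 0" using N by (simp add: \<alpha>_def)
  \<comment> \<open>the summand \<open>1\<close> leaves room for the face \<open>z $ i = - M\<close> of the box, on which \<open>w\<close> vanishes\<close>
  define M where "M = 1 + (\<Sum>x | w x \<noteq> 0. \<Sum>k\<in>UNIV. \<bar>x $ k\<bar>)"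
  define K where "K = {-M..M}"
  define box where "box = slab K UNIV (0 :: int ^ 'n)"
  have finbox: "finite box" by (simp add: box_def K_def finite_slab)
  have bound: "\<bar>x $ k\<bar> < M" if "w x \<noteq> 0" for x k
  proof -
    have "\<bar>x $ k\<bar> \<le> (\<Sum>k\<in>UNIV. \<bar>x $ k\<bar>)" by (rule member_le_sum) auto
    also have "\<dots> \<le> (\<Sum>x | w x \<noteq> 0. \<Sum>k\<in>UNIV. \<bar>x $ k\<bar>)"
      using that fin by (intro member_le_sum[of x _ "\<lambda>x. \<Sum>k\<in>UNIV. \<bar>x $ k\<bar>"]) (auto intro: sum_nonneg)
    finally show ?thesis by (simp add: M_def)
  qed
  have supp: "{x. w x \<noteq> 0} \<subseteq> box"
  proof
    fix x assume "x \<in> {x. w x \<noteq> 0}"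
    then have "x $ k \<in> K" for k using bound[of x k] by (simp add: K_def abs_less_iff)
    then show "x \<in> box" by (simp add: box_def slab_def)
  qed
  define g where "g i z = (\<Sum>t\<in>K. \<bar>w (vec_upd z i (t + 1)) - w (vec_upd z i t)\<bar>)" for i z
  define h where "h i z = \<bar>w (vec_upd z i (z $ i + 1)) - w z\<bar>" for i z
  have w_le: "\<bar>w z\<bar> \<le> g i z" if "z \<in> box" for i z
  proof -
    have zi: "-M \<le> z $ i" "z $ i \<le> M" using that by (auto simp: box_def slab_def K_def)
    have "w (vec_upd z i (-M)) = 0"
    proof (rule ccontr)
      assume "w (vec_upd z i (-M)) \<noteq> 0"
      from bound[OF this, of i] show False by simp
    qed
    from abs_le_sum_increments[of "\<lambda>t. w (vec_upd z i t)", OF this zi(1)]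
    have "\<bar>w z\<bar> \<le> (\<Sum>s\<in>{-M..<z $ i}. \<bar>w (vec_upd z i (s + 1)) - w (vec_upd z i s)\<bar>)" by simp
    also have "\<dots> \<le> g i z"
      unfolding g_def using zi by (intro sum_mono2) (auto simp: K_def)
    finally show ?thesis .
  qed
  have g_sum: "(\<Sum>z\<in>slab K (UNIV - {i}) 0. g i z) \<le> E" for i
  proof -
    have "(\<Sum>z\<in>slab K (UNIV - {i}) 0. g i z) = (\<Sum>z\<in>slab K (UNIV - {i}) 0. \<Sum>t\<in>K. h i (vec_upd z i t))"
      by (simp add: g_def h_def)
    also have "\<dots> = (\<Sum>t\<in>K. \<Sum>z\<in>slab K (UNIV - {i}) 0. h i (vec_upd z i t))"
      by (rule sum.swap)
    also have "\<dots> = (\<Sum>t\<in>K. \<Sum>z\<in>slab K (UNIV - {i}) (vec_upd 0 i t). h i z)"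
      by (simp add: sum_slab_vec_upd)
    also have "\<dots> = (\<Sum>z\<in>slab K (insert i (UNIV - {i})) 0. h i z)"
      by (rule sum_slab_insert[symmetric]) (auto simp: K_def)
    also have "insert i (UNIV - {i}) = UNIV" by auto
    also have "(\<Sum>z\<in>slab K UNIV 0. h i z) \<le> (\<Sum>z\<in>slab K UNIV 0. grad_norm 1 w z powr 1)"
    proof (rule sum_mono)
      fix z :: "int ^ 'n"
      have "lattice_adj z (vec_upd z i (z $ i + 1))"
        by (rule lattice_adj_vec_upd) simp
      then show "h i z \<le> grad_norm 1 w z powr 1"
        unfolding h_def grad_norm_powr[of 1, OF one_neq_zero]
        using member_le_sum[of "vec_upd z i (z $ i + 1)" "{y. lattice_adj z y}" "\<lambda>y. \<bar>w y - w z\<bar> powr 1"]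
        by (simp del: powr_one')
    qed
    also have "\<dots> \<le> E"
      unfolding E_def using grad_norm_powr_has_sum[of 1 w] fin finbox
      by (intro finite_sum_le_infsum) (auto simp: summable_on_def box_def)
    finally show ?thesis .
  qed
  have "(\<Sum>x | w x \<noteq> 0. \<bar>w x\<bar> powr (CARD('n) * \<alpha>)) \<le> (\<Sum>x\<in>box. \<bar>w x\<bar> powr (CARD('n) * \<alpha>))"
    by (intro sum_mono2 finbox supp) auto
  also have "\<dots> = (\<Sum>x\<in>box. \<Prod>i\<in>(UNIV :: 'n set). \<bar>w x\<bar> powr \<alpha>)"
    by (simp only: prod_const_powr)
  also have "\<dots> \<le> (\<Sum>x\<in>box. \<Prod>i\<in>(UNIV :: 'n set). g i x powr \<alpha>)"
    using w_le \<alpha>0 by (intro sum_mono prod_mono) (auto intro!: powr_mono2)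
  also have "\<dots> \<le> (\<Prod>i\<in>UNIV. (\<Sum>z\<in>slab K (UNIV - {i}) 0. g i z) powr \<alpha>)"
    unfolding box_def \<alpha>_def
    by (rule gagliardo_inequality[OF N]) (auto simp: K_def g_def intro: sum_nonneg)
  also have "\<dots> \<le> (\<Prod>i\<in>(UNIV :: 'n set). E powr \<alpha>)"
    using g_sum \<alpha>0 by (intro prod_mono) (auto intro!: powr_mono2 sum_nonneg simp: g_def)
  also have "\<dots> = E powr (CARD('n) * \<alpha>)"
    by (simp only: prod_const_powr)
  finally show ?thesis by (simp add: \<alpha>_def E_def)
qed

text \<open>
  By the mean value theorem. For \<open>b = u y\<close> and \<open>a = u x\<close> this bounds the increments of
  \<open>\<bar>u\<bar> powr \<gamma>\<close> by those of \<open>u\<close>.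
\<close>

lemma powr_diff_le:
  fixes a b \<gamma> :: real
  assumes \<gamma>: "\<gamma> \<ge> 1"
  shows "\<bar>\<bar>b\<bar> powr \<gamma> - \<bar>a\<bar> powr \<gamma>\<bar> \<le> \<gamma> * (\<bar>a\<bar> powr (\<gamma> - 1) + \<bar>b\<bar> powr (\<gamma> - 1)) * \<bar>b - a\<bar>"
proof -
  have main: "d powr \<gamma> - c powr \<gamma> \<le> \<gamma> * d powr (\<gamma> - 1) * (d - c)" if "0 \<le> c" "c < d" for c d :: real
  proof (cases "c = 0")
    case True
    then show ?thesis
      using that \<gamma> mult_right_mono[of 1 \<gamma> "d powr \<gamma>"] by (simp add: powr_diff)
  next
    case False
    have "\<exists>z>c. z < d \<and> d powr \<gamma> - c powr \<gamma> = (d - c) * (\<gamma> * z powr (\<gamma> - 1))"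
      by (rule MVT2) (use that False in \<open>auto intro!: derivative_eq_intros\<close>)
    then obtain z where z: "c < z" "z < d" "d powr \<gamma> - c powr \<gamma> = (d - c) * (\<gamma> * z powr (\<gamma> - 1))"
      by blast
    have "(d - c) * (\<gamma> * z powr (\<gamma> - 1)) \<le> (d - c) * (\<gamma> * d powr (\<gamma> - 1))"
      using z that \<gamma> by (intro mult_left_mono powr_mono2) auto
    then show ?thesis using z(3) by (simp add: mult_ac)
  qed
  have wlog: "\<bar>\<bar>b\<bar> powr \<gamma> - \<bar>a\<bar> powr \<gamma>\<bar> \<le> \<gamma> * (\<bar>a\<bar> powr (\<gamma> - 1) + \<bar>b\<bar> powr (\<gamma> - 1)) * \<bar>b - a\<bar>"
    if "\<bar>a\<bar> \<le> \<bar>b\<bar>" for a b :: real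
  proof (cases "\<bar>a\<bar> = \<bar>b\<bar>")
    case False
    with that have lt: "\<bar>a\<bar> < \<bar>b\<bar>" by simp
    then have "\<bar>a\<bar> powr \<gamma> \<le> \<bar>b\<bar> powr \<gamma>" using \<gamma> by (intro powr_mono2) auto
    then have "\<bar>\<bar>b\<bar> powr \<gamma> - \<bar>a\<bar> powr \<gamma>\<bar> = \<bar>b\<bar> powr \<gamma> - \<bar>a\<bar> powr \<gamma>" by simp
    also have "\<dots> \<le> \<gamma> * \<bar>b\<bar> powr (\<gamma> - 1) * (\<bar>b\<bar> - \<bar>a\<bar>)"
      using main[OF _ lt] by simp
    also have "\<dots> \<le> \<gamma> * (\<bar>a\<bar> powr (\<gamma> - 1) + \<bar>b\<bar> powr (\<gamma> - 1)) * \<bar>b - a\<bar>"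
      using \<gamma> lt by (intro mult_mono) auto
    finally show ?thesis .
  qed (use \<gamma> in simp)
  show ?thesis
  proof (cases "\<bar>a\<bar> \<le> \<bar>b\<bar>")
    case False
    then show ?thesis
      using wlog[of b a] by (simp add: abs_minus_commute add.commute)
  qed (rule wlog)
qed

text \<open>
  The case \<open>p = 1\<close> is applied to \<open>w = \<bar>u\<bar> powr \<gamma>\<close>. The gradient of \<open>w\<close> is at most \<open>\<gamma>\<close> times
  the sum of \<open>\<bar>u\<bar> powr (\<gamma> - 1)\<close> over both ends of an edge, times that of \<open>u\<close>. By Hoelder's inequality
  its sum is bounded by a power of \<open>X\<close>, the sum of \<open>\<bar>u\<bar> powr s\<close>, times the gradient norm of \<open>u\<close>;
  this power is smaller than the power of \<open>X\<close> on the left and can be cancelled.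
\<close>

lemma discrete_sobolev_critical:
  fixes p :: real
  assumes N: "CARD('n) \<ge> 2" and p: "1 \<le> p" "p < real CARD('n)"
  defines "s \<equiv> real CARD('n) * p / (real CARD('n) - p)"
  obtains C where "C > 0"
    "\<And>u :: int ^ 'n \<Rightarrow> real. finite {x. u x \<noteq> 0} \<Longrightarrow>
      (\<Sum>x | u x \<noteq> 0. \<bar>u x\<bar> powr s) powr (1 / s) \<le> C * (\<Sum>\<^sub>\<infinity>x. grad_norm p u x powr p) powr (1 / p)"
proof -
  define n where "n = real CARD('n)"
  have n: "n \<ge> 2" "p < n" using N p by (auto simp: n_def)
  \<comment> \<open>the choice for which \<open>\<bar>w\<bar> powr (n / (n - 1))\<close> is \<open>\<bar>u\<bar> powr s\<close> and \<open>\<bar>u\<bar> powr (\<gamma> - 1)\<close> is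
    \<open>(\<bar>u\<bar> powr s) powr (1 - 1 / p)\<close>, the factor that Hoelder's inequality handles\<close>
  define \<gamma> where "\<gamma> = p * (n - 1) / (n - p)"
  have s0: "s > 0" using n p by (simp add: s_def n_def)
  have \<gamma>1: "\<gamma> \<ge> 1" using n p by (simp add: \<gamma>_def field_simps)
  have exp1: "s * (1 - 1 / p) = \<gamma> - 1"
    using n p by (simp add: s_def \<gamma>_def n_def[symmetric] field_simps)
  have exp2: "\<gamma> * (n / (n - 1)) = s"
  proof -
    have "n - 1 \<noteq> 0" using n by simp
    then show ?thesis by (simp add: s_def \<gamma>_def n_def[symmetric] mult.commute)
  qed
  have exp3: "(n - 1) / n - (1 - 1 / p) = 1 / s"
    using n p by (simp add: s_def n_def[symmetric] field_simps)
  define C where "C = 2 * \<gamma> * (3 powr n) powr (1 - 1 / p)"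
  have "(\<Sum>x | u x \<noteq> 0. \<bar>u x\<bar> powr s) powr (1 / s) \<le> C * (\<Sum>\<^sub>\<infinity>x. grad_norm p u x powr p) powr (1 / p)"
    if fin: "finite {x. u x \<noteq> 0}" for u :: "int ^ 'n \<Rightarrow> real"
  proof -
    define A where "A = {x. u x \<noteq> 0}"
    define X where "X = (\<Sum>x\<in>A. \<bar>u x\<bar> powr s)"
    define E where "E = (\<Sum>\<^sub>\<infinity>x. grad_norm p u x powr p)"
    define w where "w x = \<bar>u x\<bar> powr \<gamma>" for x
    define T where "T = Sigma (nbhd A) (\<lambda>x. {y. lattice_adj x y})"
    have finA: "finite A" and finQ: "finite (nbhd A)"
      using fin finite_nbhd by (auto simp: A_def)
    have w_supp: "{x. w x \<noteq> 0} = A" by (auto simp: w_def A_def)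
    have E_eq: "E = (\<Sum>(x, y)\<in>T. \<bar>u y - u x\<bar> powr p)"
      using infsumI[OF grad_norm_powr_has_sum[of p u]] fin p finQ
      by (simp add: E_def A_def T_def sum.Sigma)
    have Ew: "(\<Sum>\<^sub>\<infinity>x. grad_norm 1 w x powr 1) = (\<Sum>(x, y)\<in>T. \<bar>w y - w x\<bar>)"
      using infsumI[OF grad_norm_powr_has_sum[of 1 w]] w_supp finA finQ
      by (simp add: T_def sum.Sigma)
    have mass1: "(\<Sum>(x, y)\<in>T. \<bar>u x\<bar> powr s) \<le> 3 powr n * X"
    proof -
      have "(\<Sum>(x, y)\<in>T. \<bar>u x\<bar> powr s) = (\<Sum>x\<in>nbhd A. real (card {y. lattice_adj x y}) * \<bar>u x\<bar> powr s)"
        unfolding T_def using finQ by (subst sum.Sigma[symmetric]) auto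
      also have "\<dots> = (\<Sum>x\<in>A. real (card {y. lattice_adj x y}) * \<bar>u x\<bar> powr s)"
        using finQ by (intro sum.mono_neutral_right) (auto simp: nbhd_def A_def)
      also have "\<dots> \<le> (\<Sum>x\<in>A. 3 powr n * \<bar>u x\<bar> powr s)"
      proof (intro sum_mono mult_right_mono)
        fix x :: "int ^ 'n"
        show "real (card {y. lattice_adj x y}) \<le> 3 powr n"
          using of_nat_mono[OF card_nbrs_le[of x], where 'a = real] by (simp add: n_def powr_realpow)
      qed auto
      finally show ?thesis by (simp add: X_def sum_distrib_left)
    qed
    \<comment> \<open>exchanging the two ends of each edge reduces this to the previous bound\<close>
    have mass2: "(\<Sum>(x, y)\<in>T. \<bar>u y\<bar> powr s) \<le> 3 powr n * X"
    proof -
      have "(\<Sum>(x, y)\<in>T. \<bar>u y\<bar> powr s) = (\<Sum>(x, y)\<in>{(x, y) \<in> T. y \<in> nbhd A}. \<bar>u y\<bar> powr s)"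
      proof (rule sum.mono_neutral_right)
        show "finite T" using finQ by (simp add: T_def)
      qed (auto simp: nbhd_def A_def)
      also have "\<dots> = (\<Sum>(x, y)\<in>{(x, y) \<in> T. y \<in> nbhd A}. \<bar>u x\<bar> powr s)"
        by (rule sum.reindex_bij_witness[of _ "\<lambda>(x, y). (y, x)" "\<lambda>(x, y). (y, x)"])
          (auto simp: T_def lattice_adj_sym)
      also have "\<dots> \<le> (\<Sum>(x, y)\<in>T. \<bar>u x\<bar> powr s)"
        using finQ by (intro sum_mono2) (auto simp: T_def)
      finally show ?thesis using mass1 by simp
    qed
    have holder: "(\<Sum>(x, y)\<in>T. m x y powr (1 - 1 / p) * \<bar>u y - u x\<bar>) \<le> (3 powr n * X) powr (1 - 1 / p) * E powr (1 / p)"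
      if "\<And>x y. m x y \<ge> 0" and le: "(\<Sum>(x, y)\<in>T. m x y) \<le> 3 powr n * X" for m
    proof -
      have "(\<Sum>(x, y)\<in>T. m x y powr (1 - 1 / p) * \<bar>u y - u x\<bar>)
          \<le> (\<Sum>(x, y)\<in>T. m x y) powr (1 - 1 / p) * E powr (1 / p)"
        using holder_sum_weighted[OF p(1), of T "\<lambda>(x, y). m x y" "\<lambda>(x, y). \<bar>u y - u x\<bar>"] that(1)
        by (simp add: E_eq case_prod_beta)
      also have "\<dots> \<le> (3 powr n * X) powr (1 - 1 / p) * E powr (1 / p)"
        using le p that(1) by (intro mult_right_mono powr_mono2) (auto intro!: sum_nonneg)
      finally show ?thesis .
    qed
    have "X powr ((n - 1) / n) \<le> (\<Sum>(x, y)\<in>T. \<bar>w y - w x\<bar>)"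
    proof -
      have "X = (\<Sum>x\<in>A. \<bar>w x\<bar> powr (n / (n - 1)))"
        using exp2 by (simp add: X_def w_def powr_powr)
      also have "\<dots> \<le> (\<Sum>(x, y)\<in>T. \<bar>w y - w x\<bar>) powr (n / (n - 1))"
        using gagliardo_nirenberg_1[OF N, of w, unfolded w_supp Ew] finA by (simp add: n_def)
      finally have "X powr ((n - 1) / n) \<le> ((\<Sum>(x, y)\<in>T. \<bar>w y - w x\<bar>) powr (n / (n - 1))) powr ((n - 1) / n)"
        using n by (intro powr_mono2) (auto simp: X_def intro: sum_nonneg)
      also have "\<dots> = (\<Sum>(x, y)\<in>T. \<bar>w y - w x\<bar>)"
        using n by (simp add: powr_powr sum_nonneg case_prod_beta)
      finally show ?thesis .
    qed
    also have "\<dots> \<le> (\<Sum>(x, y)\<in>T. \<gamma> * ((\<bar>u x\<bar> powr s) powr (1 - 1 / p) * \<bar>u y - u x\<bar>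
        + (\<bar>u y\<bar> powr s) powr (1 - 1 / p) * \<bar>u y - u x\<bar>))"
    proof (rule sum_mono, clarify)
      fix x y
      show "\<bar>w y - w x\<bar> \<le> \<gamma> * ((\<bar>u x\<bar> powr s) powr (1 - 1 / p) * \<bar>u y - u x\<bar>
        + (\<bar>u y\<bar> powr s) powr (1 - 1 / p) * \<bar>u y - u x\<bar>)"
        using powr_diff_le[OF \<gamma>1, of "u y" "u x"] by (simp only: powr_powr exp1 w_def) (simp add: algebra_simps)
    qed
    also have "\<dots> = \<gamma> * ((\<Sum>(x, y)\<in>T. (\<bar>u x\<bar> powr s) powr (1 - 1 / p) * \<bar>u y - u x\<bar>)
        + (\<Sum>(x, y)\<in>T. (\<bar>u y\<bar> powr s) powr (1 - 1 / p) * \<bar>u y - u x\<bar>))"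
      by (simp add: case_prod_beta sum_distrib_left sum.distrib distrib_left)
    also have "\<dots> \<le> \<gamma> * ((3 powr n * X) powr (1 - 1 / p) * E powr (1 / p)
        + (3 powr n * X) powr (1 - 1 / p) * E powr (1 / p))"
      using \<gamma>1 by (intro mult_left_mono add_mono holder mass1 mass2) auto
    also have "\<dots> = X powr (1 - 1 / p) * (C * E powr (1 / p))"
      by (simp add: C_def powr_mult)
    finally have key: "X powr ((n - 1) / n) \<le> X powr (1 - 1 / p) * (C * E powr (1 / p))" .
    have "X powr (1 / s) \<le> C * E powr (1 / p)"
    proof (cases "X = 0")
      case False
      then have "X > 0" by (simp add: X_def sum_nonneg less_le)
      have "X powr (1 / s) = X powr ((n - 1) / n) / X powr (1 - 1 / p)"
        unfolding exp3[symmetric] by (rule powr_diff)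
      also have "\<dots> \<le> C * E powr (1 / p)"
        using key \<open>X > 0\<close> by (simp add: divide_le_eq mult.commute)
      finally show ?thesis .
    qed (use \<gamma>1 in \<open>simp add: C_def\<close>)
    then show ?thesis by (simp add: X_def A_def E_def)
  qed
  moreover have "C > 0" using \<gamma>1 by (simp add: C_def)
  ultimately show ?thesis using that by blast
qed

text \<open>
  Each term of the sum on the right is at most the whole sum.
\<close>

lemma sum_powr_le_powr_sum:
  fixes a :: "'a \<Rightarrow> real"
  assumes "0 < s" "s \<le> q"
  shows "(\<Sum>x\<in>A. \<bar>a x\<bar> powr q) \<le> (\<Sum>x\<in>A. \<bar>a x\<bar> powr s) powr (q / s)"
proof (cases "finite A")
  case fin: True
  define X where "X = (\<Sum>x\<in>A. \<bar>a x\<bar> powr s)"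
  have X0: "X \<ge> 0" by (simp add: X_def sum_nonneg)
  have "\<bar>a x\<bar> powr q \<le> \<bar>a x\<bar> powr s * X powr (q / s - 1)" if "x \<in> A" for x
  proof -
    have le: "\<bar>a x\<bar> powr s \<le> X"
      unfolding X_def using fin that by (intro member_le_sum) auto
    have "\<bar>a x\<bar> powr q = \<bar>a x\<bar> powr s * (\<bar>a x\<bar> powr s) powr (q / s - 1)"
      using assms by (simp add: powr_powr algebra_simps flip: powr_add)
    also have "\<dots> \<le> \<bar>a x\<bar> powr s * X powr (q / s - 1)"
      using assms le by (intro mult_left_mono powr_mono2) auto
    finally show ?thesis .
  qed
  then have "(\<Sum>x\<in>A. \<bar>a x\<bar> powr q) \<le> (\<Sum>x\<in>A. \<bar>a x\<bar> powr s * X powr (q / s - 1))"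
    by (rule sum_mono)
  also have "\<dots> = X * X powr (q / s - 1)" by (simp add: X_def sum_distrib_right)
  also have "\<dots> = X powr (q / s)" using X0 by (simp add: powr_mult_base)
  finally show ?thesis by (simp add: X_def)
qed simp

lemma discrete_sobolev_finitely_supported:
  fixes p q :: real
  assumes N: "CARD('n) \<ge> 2" and p: "1 \<le> p" "p < real CARD('n)"
    and q: "q \<ge> real CARD('n) * p / (real CARD('n) - p)"
  obtains C where "C > 0"
    "\<And>u :: int ^ 'n \<Rightarrow> real. finite {x. u x \<noteq> 0} \<Longrightarrow>
      (\<Sum>\<^sub>\<infinity>x. \<bar>u x\<bar> powr q) \<le> C * (\<Sum>\<^sub>\<infinity>x. grad_norm p u x powr p) powr (q / p)"
proof -
  define s where "s = real CARD('n) * p / (real CARD('n) - p)"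
  have s0: "s > 0" and sq: "s \<le> q" using p q by (auto simp: s_def)
  obtain C where C: "C > 0" and sob: "\<And>u :: int ^ 'n \<Rightarrow> real. finite {x. u x \<noteq> 0} \<Longrightarrow>
      (\<Sum>x | u x \<noteq> 0. \<bar>u x\<bar> powr s) powr (1 / s) \<le> C * (\<Sum>\<^sub>\<infinity>x. grad_norm p u x powr p) powr (1 / p)"
    by (rule discrete_sobolev_critical[OF N p, folded s_def]) (rule that)
  show ?thesis
  proof (rule that[of "C powr q"])
    fix u :: "int ^ 'n \<Rightarrow> real" assume fin: "finite {x. u x \<noteq> 0}"
    define E where "E = (\<Sum>\<^sub>\<infinity>x. grad_norm p u x powr p)"
    have "((\<lambda>x. \<bar>u x\<bar> powr q) has_sum (\<Sum>x | u x \<noteq> 0. \<bar>u x\<bar> powr q)) UNIV"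
      by (rule has_sum_finite_neutralI[OF fin]) auto
    then have "(\<Sum>\<^sub>\<infinity>x. \<bar>u x\<bar> powr q) = (\<Sum>x | u x \<noteq> 0. \<bar>u x\<bar> powr q)"
      by (rule infsumI)
    also have "\<dots> \<le> (\<Sum>x | u x \<noteq> 0. \<bar>u x\<bar> powr s) powr (q / s)"
      by (rule sum_powr_le_powr_sum[OF s0 sq])
    also have "\<dots> = ((\<Sum>x | u x \<noteq> 0. \<bar>u x\<bar> powr s) powr (1 / s)) powr q"
      by (simp add: powr_powr)
    also have "\<dots> \<le> (C * E powr (1 / p)) powr q"
      unfolding E_def using sob[OF fin] s0 sq by (intro powr_mono2) auto
    also have "\<dots> = C powr q * E powr (q / p)"
      by (simp add: powr_mult powr_powr)
    finally show "(\<Sum>\<^sub>\<infinity>x. \<bar>u x\<bar> powr q) \<le> C powr q * (\<Sum>\<^sub>\<infinity>x. grad_norm p u x powr p) powr (q / p)"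
      by (simp add: E_def)
  qed (use C in simp)
qed

section \<open>Limit theorems for sums\<close>

text \<open>
  Lebesgue's theorem for the counting measure.
\<close>

lemma infsum_dominated_convergence:
  fixes f :: "nat \<Rightarrow> 'a \<Rightarrow> real"
  assumes g: "g summable_on A"
    and le: "\<And>n x. x \<in> A \<Longrightarrow> \<bar>f n x\<bar> \<le> g x"
    and lim: "\<And>x. x \<in> A \<Longrightarrow> (\<lambda>n. f n x) \<longlonglongrightarrow> l x"
  shows "(\<lambda>n. infsum (f n) A) \<longlonglongrightarrow> infsum l A"
proof -
  have g0: "g x \<ge> 0" if "x \<in> A" for x
    using le[OF that, of 0] by linarith
  have gi: "integrable (count_space A) g"
    using g g0 abs_summable_equivalent[of g A]
    by (simp add: abs_summable_on_def cong: summable_on_cong)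
  have fs: "(\<lambda>x. norm (f n x)) summable_on A" for n
    by (rule summable_on_comparison_test[OF g]) (use le in auto)
  have l_le: "\<bar>l x\<bar> \<le> g x" if "x \<in> A" for x
    by (rule tendsto_upperbound[OF tendsto_rabs[OF lim[OF that]]]) (use le that in auto)
  have ls: "(\<lambda>x. norm (l x)) summable_on A"
    by (rule summable_on_comparison_test[OF g]) (use l_le in auto)
  have "(\<lambda>n. integral\<^sup>L (count_space A) (f n)) \<longlonglongrightarrow> integral\<^sup>L (count_space A) l"
    by (rule integral_dominated_convergence[where w = g])
      (use gi lim le in \<open>auto simp: AE_count_space\<close>)
  moreover have "infsetsum (f n) A = infsum (f n) A" for n
    using fs abs_summable_equivalent infsetsum_infsum by blast
  moreover have "infsetsum l A = infsum l A"
    using ls abs_summable_equivalent infsetsum_infsum by blast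
  ultimately show ?thesis
    by (simp add: infsetsum_def)
qed

lemma nonneg_summable_on_bounded_sums:
  fixes f :: "'a \<Rightarrow> real"
  assumes "\<And>x. f x \<ge> 0" and le: "\<And>F. finite F \<Longrightarrow> sum f F \<le> B"
  shows "f summable_on UNIV" and "infsum f UNIV \<le> B"
proof -
  show "f summable_on UNIV"
    by (rule nonneg_bdd_above_summable_on) (use assms in \<open>auto simp: bdd_above_def\<close>)
  then show "infsum f UNIV \<le> B"
    by (rule infsum_le_finite_sums) (use le in auto)
qed

text \<open>
  Fatou's lemma for sums, with a varying bound.
\<close>

lemma nonneg_summable_on_pointwise_limit:
  fixes f :: "nat \<Rightarrow> 'a \<Rightarrow> real"
  assumes nn: "\<And>n x. f n x \<ge> 0"
    and lim: "\<And>x. (\<lambda>n. f n x) \<longlonglongrightarrow> l x"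
    and sm: "\<And>n. f n summable_on UNIV"
    and le: "\<And>n. infsum (f n) UNIV \<le> b n" and b: "b \<longlonglongrightarrow> B"
  shows "l summable_on UNIV" and "infsum l UNIV \<le> B"
proof -
  have "l x \<ge> 0" for x
    by (rule tendsto_lowerbound[OF lim]) (use nn in auto)
  moreover have "sum l F \<le> B" if "finite F" for F
  proof (rule LIMSEQ_le)
    show "(\<lambda>n. sum (f n) F) \<longlonglongrightarrow> sum l F"
      by (intro tendsto_sum lim)
    have "sum (f n) F \<le> b n" for n
      using finite_sum_le_infsum[OF sm that, of n] nn le[of n] by force
    then show "\<exists>N. \<forall>n\<ge>N. sum (f n) F \<le> b n" by blast
  qed (rule b)
  ultimately show "l summable_on UNIV" "infsum l UNIV \<le> B"
    using nonneg_summable_on_bounded_sums by blast+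
qed

lemma summable_on_finite_superlevel:
  fixes f :: "'a \<Rightarrow> real"
  assumes f: "f summable_on UNIV" and f0: "\<And>x. f x \<ge> 0" and "\<epsilon> > 0"
  shows "finite {x. f x \<ge> \<epsilon>}"
proof (rule ccontr)
  assume inf: "infinite {x. f x \<ge> \<epsilon>}"
  obtain n where n: "infsum f UNIV < real n * \<epsilon>"
    using \<open>\<epsilon> > 0\<close> reals_Archimedean3 by blast
  obtain F where F: "F \<subseteq> {x. f x \<ge> \<epsilon>}" "finite F" "card F = n"
    using infinite_arbitrarily_large[OF inf] by blast
  have "real n * \<epsilon> = (\<Sum>x\<in>F. \<epsilon>)" using F by simp
  also have "\<dots> \<le> sum f F" using F by (intro sum_mono) auto
  also have "\<dots> \<le> infsum f UNIV" using F f f0 by (intro finite_sum_le_infsum) auto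
  finally show False using n by simp
qed

section \<open>The splitting of Brezis and Lieb\<close>

text \<open>
  Either \<open>b\<close> is small compared with \<open>a\<close>, or \<open>a\<close> is at most a multiple of \<open>b\<close>. The coefficient of
  the first summand can be made as close to \<open>1\<close> as desired.
\<close>

lemma abs_add_powr_le:
  fixes a b p \<delta> :: real
  assumes "p > 0" "\<delta> > 0"
  shows "\<bar>a + b\<bar> powr p \<le> (1 + \<delta>) powr p * \<bar>a\<bar> powr p + (1 + 1 / \<delta>) powr p * \<bar>b\<bar> powr p"
proof (cases "\<bar>b\<bar> \<le> \<delta> * \<bar>a\<bar>")
  case True
  then have "\<bar>a + b\<bar> \<le> (1 + \<delta>) * \<bar>a\<bar>"
    by (simp add: algebra_simps)
  then have "\<bar>a + b\<bar> powr p \<le> ((1 + \<delta>) * \<bar>a\<bar>) powr p"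
    by (intro powr_mono2) (use assms in auto)
  then show ?thesis
    by (simp add: powr_mult add_increasing2)
next
  case False
  then have "\<bar>a\<bar> \<le> 1 / \<delta> * \<bar>b\<bar>"
    using assms by (simp add: field_simps)
  then have "\<bar>a + b\<bar> \<le> (1 + 1 / \<delta>) * \<bar>b\<bar>"
    by (simp add: algebra_simps)
  then have "\<bar>a + b\<bar> powr p \<le> ((1 + 1 / \<delta>) * \<bar>b\<bar>) powr p"
    by (intro powr_mono2) (use assms in auto)
  then show ?thesis
    by (simp add: powr_mult add_increasing)
qed

lemma abs_add_powr_le2:
  fixes a b p :: real
  assumes "p > 0"
  shows "\<bar>a + b\<bar> powr p \<le> 2 powr p * (\<bar>a\<bar> powr p + \<bar>b\<bar> powr p)"
  using abs_add_powr_le[of p 1 a b] assms by (simp add: distrib_left)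

text \<open>
  The preceding bound, used for \<open>a = (a - b) + b\<close> and for \<open>a - b = a + (- b)\<close>.
\<close>

lemma abs_powr_split:
  fixes p \<epsilon> :: real
  assumes "p > 0" "\<epsilon> > 0"
  shows "\<exists>C. \<forall>a b :: real. \<bar>\<bar>a\<bar> powr p - \<bar>a - b\<bar> powr p\<bar> \<le> \<epsilon> * \<bar>a - b\<bar> powr p + C * \<bar>b\<bar> powr p"
proof -
  define \<eta> where "\<eta> = min (\<epsilon> / 2) 1"
  have \<eta>: "0 < \<eta>" "\<eta> \<le> 1" "\<eta> \<le> \<epsilon> / 2"
    using assms by (auto simp: \<eta>_def)
  \<comment> \<open>the solution of \<open>(1 + \<delta>) powr p = 1 + \<eta>\<close>\<close>
  define \<delta> where "\<delta> = (1 + \<eta>) powr (1 / p) - 1"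
  have \<delta>: "\<delta> > 0"
    using \<eta> assms by (simp add: \<delta>_def gr_one_powr)
  have \<delta>p: "(1 + \<delta>) powr p = 1 + \<eta>"
    using \<eta> assms by (simp add: \<delta>_def powr_powr)
  define K where "K = (1 + 1 / \<delta>) powr p"
  have K0: "K \<ge> 0" by (simp add: K_def)
  have up: "\<bar>a + b\<bar> powr p \<le> (1 + \<eta>) * \<bar>a\<bar> powr p + K * \<bar>b\<bar> powr p" for a b
    using abs_add_powr_le[OF assms(1) \<delta>, of a b] by (simp add: \<delta>p K_def)
  have main: "\<bar>\<bar>a + b\<bar> powr p - \<bar>a\<bar> powr p\<bar> \<le> \<epsilon> * \<bar>a\<bar> powr p + 3 * K * \<bar>b\<bar> powr p" for a b
  proof -
    define A B D where "A = \<bar>a\<bar> powr p" and "B = \<bar>b\<bar> powr p" and "D = \<bar>a + b\<bar> powr p"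
    have nn: "A \<ge> 0" "B \<ge> 0" "D \<ge> 0" by (auto simp: A_def B_def D_def)
    have 1: "D \<le> (1 + \<eta>) * A + K * B"
      using up[of a b] by (simp add: A_def B_def D_def)
    have 2: "A \<le> (1 + \<eta>) * D + K * B"
      using up[of "a + b" "- b"] by (simp add: A_def B_def D_def)
    have e1: "\<eta> * A \<le> \<epsilon> / 2 * A" using \<eta> nn by (intro mult_right_mono) auto
    have KB: "0 \<le> K * B" using K0 nn by simp
    have e0: "0 \<le> \<epsilon> * A" using assms nn by simp
    have "\<eta> * A \<le> A" "\<eta> * (K * B) \<le> K * B"
      using \<eta> nn KB by (auto intro!: mult_left_le_one_le)
    have "\<eta> * D \<le> \<eta> * ((1 + \<eta>) * A + K * B)"
      using 1 \<eta> by (intro mult_left_mono) auto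
    also have "\<dots> = \<eta> * A + \<eta> * (\<eta> * A) + \<eta> * (K * B)"
      by (simp add: algebra_simps)
    also have "\<eta> * (\<eta> * A) \<le> \<eta> * A"
      using \<eta> nn by (intro mult_left_le_one_le) auto
    finally have "\<eta> * D \<le> \<epsilon> * A + K * B"
      using e1 \<open>\<eta> * (K * B) \<le> K * B\<close> by linarith
    then have "A - D \<le> \<epsilon> * A + 3 * (K * B)" "D - A \<le> \<epsilon> * A + 3 * (K * B)"
      using 1 2 KB e1 e0 by (auto simp: distrib_right)
    then show ?thesis
      by (simp add: A_def B_def D_def mult.assoc abs_le_iff)
  qed
  show ?thesis
  proof (intro exI allI)
    show "\<bar>\<bar>a\<bar> powr p - \<bar>a - b\<bar> powr p\<bar> \<le> \<epsilon> * \<bar>a - b\<bar> powr p + 3 * K * \<bar>b\<bar> powr p" for a b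
      using main[of "a - b" b] by simp
  qed
qed

text \<open>
  The scalar inequality, for the increments of \<open>u\<close> and \<open>w\<close>, summed over the neighbours of \<open>x\<close>.
\<close>

lemma grad_norm_powr_split:
  fixes p :: real
  assumes p: "p > 0" and \<epsilon>: "\<epsilon> > 0"
  shows "\<exists>C. \<forall>(u :: int ^ 'n \<Rightarrow> real) w x. \<bar>grad_norm p u x powr p - grad_norm p (\<lambda>y. u y - w y) x powr p\<bar>
    \<le> \<epsilon> * grad_norm p (\<lambda>y. u y - w y) x powr p + C * grad_norm p w x powr p"
proof -
  obtain C where C: "\<And>a b :: real. \<bar>\<bar>a\<bar> powr p - \<bar>a - b\<bar> powr p\<bar> \<le> \<epsilon> * \<bar>a - b\<bar> powr p + C * \<bar>b\<bar> powr p"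
    using abs_powr_split[OF assms] by blast
  show ?thesis
  proof (intro exI allI)
    fix u w :: "int ^ 'n \<Rightarrow> real" and x
    have eq: "(u y - w y) - (u x - w x) = (u y - u x) - (w y - w x)" for y by simp
    have "\<bar>grad_norm p u x powr p - grad_norm p (\<lambda>y. u y - w y) x powr p\<bar>
        \<le> (\<Sum>y | lattice_adj x y. \<bar>\<bar>u y - u x\<bar> powr p - \<bar>(u y - u x) - (w y - w x)\<bar> powr p\<bar>)"
      unfolding grad_norm_powr[OF less_imp_neq[OF p, symmetric]] eq sum_subtractf[symmetric]
      by (rule sum_abs)
    also have "\<dots> \<le> (\<Sum>y | lattice_adj x y. \<epsilon> * \<bar>(u y - u x) - (w y - w x)\<bar> powr p + C * \<bar>w y - w x\<bar> powr p)"
      by (intro sum_mono C)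
    also have "\<dots> = \<epsilon> * grad_norm p (\<lambda>y. u y - w y) x powr p + C * grad_norm p w x powr p"
      unfolding grad_norm_powr[OF less_imp_neq[OF p, symmetric]] eq by (simp add: sum.distrib sum_distrib_left)
    finally show "\<bar>grad_norm p u x powr p - grad_norm p (\<lambda>y. u y - w y) x powr p\<bar>
      \<le> \<epsilon> * grad_norm p (\<lambda>y. u y - w y) x powr p + C * grad_norm p w x powr p" .
  qed
qed

text \<open>
  The typical case is \<open>a n = \<bar>f n\<bar> powr q\<close>, \<open>b n = \<bar>f n - l\<bar> powr q\<close> and \<open>c = \<bar>l\<bar> powr q\<close>, where
  \<open>f n\<close> converges to \<open>l\<close> pointwise. Stated for the densities, the lemma also covers gradients.
  The total of \<open>\<bar>a n - b n - c\<bar>\<close> tends to \<open>0\<close>: up to \<open>\<epsilon> * b n\<close>, whose total is at most \<open>\<epsilon> * B\<close>,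
  this function is dominated by a multiple of \<open>c\<close>, and it tends to \<open>0\<close> pointwise.
\<close>

lemma brezis_lieb_infsum:
  fixes a b :: "nat \<Rightarrow> 'a \<Rightarrow> real" and c :: "'a \<Rightarrow> real"
  assumes cs: "c summable_on UNIV" and c0: "\<And>x. c x \<ge> 0"
    and as: "\<And>n. a n summable_on UNIV"
    and bs: "\<And>n. b n summable_on UNIV" and b0: "\<And>n x. b n x \<ge> 0"
    and B: "\<And>n. infsum (b n) UNIV \<le> B"
    and alim: "\<And>x. (\<lambda>n. a n x) \<longlonglongrightarrow> c x" and blim: "\<And>x. (\<lambda>n. b n x) \<longlonglongrightarrow> 0"
    and cmp: "\<And>\<epsilon>. \<epsilon> > 0 \<Longrightarrow> \<exists>C. \<forall>n x. \<bar>a n x - b n x\<bar> \<le> \<epsilon> * b n x + C * c x"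
  shows "(\<lambda>n. infsum (a n) UNIV - infsum (b n) UNIV) \<longlonglongrightarrow> infsum c UNIV"
proof -
  have B0: "B \<ge> 0" using B[of 0] infsum_nonneg[of UNIV "b 0"] b0 by force
  have dsum: "((\<lambda>x. a n x + - b n x + - c x) has_sum
      (infsum (a n) UNIV + - infsum (b n) UNIV + - infsum c UNIV)) UNIV" for n
    using as bs cs by (intro has_sum_add has_sum_uminusI has_sum_infsum)
  have diff: "infsum (a n) UNIV - infsum (b n) UNIV - infsum c UNIV
      = (\<Sum>\<^sub>\<infinity>x. a n x - b n x - c x)" for n
    using infsumI[OF dsum[of n]] by simp
  have ds: "(\<lambda>x. a n x - b n x - c x) summable_on UNIV" for n
    using dsum[of n] by (auto simp: summable_on_def)
  have "(\<lambda>n. infsum (a n) UNIV - infsum (b n) UNIV - infsum c UNIV) \<longlonglongrightarrow> 0"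
  proof (rule LIMSEQ_I)
    fix r :: real assume r: "r > 0"
    define \<epsilon> where "\<epsilon> = r / (2 * (B + 1))"
    have \<epsilon>: "\<epsilon> > 0" "\<epsilon> * B < r / 2"
      using r B0 by (auto simp: \<epsilon>_def field_simps)
    obtain C where C: "\<And>n x. \<bar>a n x - b n x\<bar> \<le> \<epsilon> * b n x + C * c x"
      using cmp[OF \<epsilon>(1)] by blast
    \<comment> \<open>the part of the defect that is not absorbed by \<open>\<epsilon> * b n\<close> is dominated by a multiple of \<open>c\<close>\<close>
    define h where "h n x = max 0 (\<bar>a n x - b n x - c x\<bar> - \<epsilon> * b n x)" for n x
    have h_le: "\<bar>h n x\<bar> \<le> (\<bar>C\<bar> + 1) * c x" for n x
    proof -
      have "\<bar>a n x - b n x - c x\<bar> \<le> \<epsilon> * b n x + C * c x + c x"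
        using C[of n x] c0[of x] by linarith
      also have "C * c x \<le> \<bar>C\<bar> * c x"
        using c0 by (intro mult_right_mono) auto
      finally show ?thesis
        using c0[of x] by (simp add: h_def distrib_right)
    qed
    have hs: "h n summable_on UNIV" for n
      by (rule summable_on_comparison_test[of "\<lambda>x. (\<bar>C\<bar> + 1) * c x"])
        (use h_le[of n] cs in \<open>auto simp: h_def intro!: summable_on_cmult_right\<close>)
    have "(\<lambda>n. infsum (h n) UNIV) \<longlonglongrightarrow> infsum (\<lambda>_ :: 'a. 0) UNIV"
    proof (rule infsum_dominated_convergence)
      show "(\<lambda>x. (\<bar>C\<bar> + 1) * c x) summable_on UNIV"
        using cs by (intro summable_on_cmult_right)
      fix x
      have "(\<lambda>n. h n x) \<longlonglongrightarrow> max 0 (\<bar>c x - 0 - c x\<bar> - \<epsilon> * 0)"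
        unfolding h_def by (intro tendsto_intros alim blim)
      then show "(\<lambda>n. h n x) \<longlonglongrightarrow> 0" by simp
    qed (rule h_le)
    then have "\<forall>\<^sub>F n in sequentially. infsum (h n) UNIV < r / 2"
      using r by (intro order_tendstoD(2)) auto
    then obtain N where N: "\<And>n. n \<ge> N \<Longrightarrow> infsum (h n) UNIV < r / 2"
      unfolding eventually_sequentially by blast
    show "\<exists>N. \<forall>n\<ge>N. norm (infsum (a n) UNIV - infsum (b n) UNIV - infsum c UNIV - 0) < r"
    proof (intro exI allI impI)
      fix n assume n: "n \<ge> N"
      have "norm (\<Sum>\<^sub>\<infinity>x. a n x - b n x - c x) \<le> (\<Sum>\<^sub>\<infinity>x. \<epsilon> * b n x + h n x)"
      proof (rule norm_infsum_le)
        show "((\<lambda>x. \<epsilon> * b n x + h n x) has_sum (\<Sum>\<^sub>\<infinity>x. \<epsilon> * b n x + h n x)) UNIV"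
          using bs hs by (intro has_sum_infsum summable_on_add summable_on_cmult_right)
        show "((\<lambda>x. a n x - b n x - c x) has_sum (\<Sum>\<^sub>\<infinity>x. a n x - b n x - c x)) UNIV"
          using ds by (rule has_sum_infsum)
      qed (simp add: h_def)
      also have "\<dots> = \<epsilon> * infsum (b n) UNIV + infsum (h n) UNIV"
        using bs hs by (simp add: infsum_add summable_on_cmult_right infsum_cmult_right)
      also have "\<dots> < r"
        using N[OF n] \<epsilon> mult_left_mono[OF B[of n] less_imp_le[OF \<epsilon>(1)]] by linarith
      finally show "norm (infsum (a n) UNIV - infsum (b n) UNIV - infsum c UNIV - 0) < r"
        by (simp add: diff)
    qed
  qed
  then show ?thesis
    using LIM_zero_cancel by fastforce
qed

section \<open>Weak-star convergence and mass at infinity\<close>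

lemma ell_1_iff: "f \<in> ell 1 \<longleftrightarrow> f summable_on UNIV"
  for f :: "'a \<Rightarrow> real"
  unfolding ell_def by (subst summable_on_iff_abs_summable_on_real) simp

text \<open>
  Replacing a test function \<open>h\<close> by a uniform approximation \<open>\<psi>\<close> of finite support costs at most
  \<open>\<epsilon>\<close> times the mass of \<open>g\<close>, and leaves a finite sum.
\<close>

lemma infsum_mult_uniform_approx:
  fixes g h \<psi> :: "'a \<Rightarrow> real"
  assumes fin: "finite {x. \<psi> x \<noteq> 0}" and \<psi>: "\<And>x. \<bar>h x - \<psi> x\<bar> \<le> \<epsilon>"
    and g0: "\<And>x. g x \<ge> 0" and gs: "g summable_on UNIV"
  shows "\<bar>(\<Sum>\<^sub>\<infinity>x. g x * h x) - (\<Sum>x | \<psi> x \<noteq> 0. g x * \<psi> x)\<bar> \<le> \<epsilon> * infsum g UNIV"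
proof -
  have le: "norm (g x * (h x - \<psi> x)) \<le> \<epsilon> * g x" for x
    using mult_left_mono[OF \<psi> g0, of x x] g0[of x] by (simp add: abs_mult mult.commute)
  have s1: "(\<lambda>x. g x * (h x - \<psi> x)) summable_on UNIV"
  proof (rule abs_summable_summable, rule summable_on_comparison_test)
    show "(\<lambda>x. \<epsilon> * g x) summable_on UNIV"
      using gs by (rule summable_on_cmult_right)
  qed (use le in auto)
  have "norm (\<Sum>\<^sub>\<infinity>x. g x * (h x - \<psi> x)) \<le> \<epsilon> * infsum g UNIV"
    by (rule norm_infsum_le[OF has_sum_infsum[OF s1] has_sum_cmult_right[OF has_sum_infsum[OF gs]]])
      (rule le)
  moreover have "((\<lambda>x. g x * (h x - \<psi> x) + g x * \<psi> x) has_sum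
      (\<Sum>\<^sub>\<infinity>x. g x * (h x - \<psi> x)) + (\<Sum>x | \<psi> x \<noteq> 0. g x * \<psi> x)) UNIV"
    using has_sum_infsum[OF s1] by (rule has_sum_add) (rule has_sum_finite_neutralI[OF fin], auto)
  then have "(\<Sum>\<^sub>\<infinity>x. g x * h x) = (\<Sum>\<^sub>\<infinity>x. g x * (h x - \<psi> x)) + (\<Sum>x | \<psi> x \<noteq> 0. g x * \<psi> x)"
    by (intro infsumI) (simp add: algebra_simps)
  ultimately show ?thesis by simp
qed

text \<open>
  A test function in \<open>c0\<close> is uniformly close to one of finite support. The error is uniform in
  \<open>n\<close> by the mass bound, and for finite support pointwise convergence suffices.
\<close>

lemma weak_star_ell1_nonneg_bounded:
  fixes f :: "nat \<Rightarrow> 'a \<Rightarrow> real"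
  assumes f0: "\<And>n x. f n x \<ge> 0" and fs: "\<And>n. f n summable_on UNIV"
    and B: "\<And>n. infsum (f n) UNIV \<le> B"
    and lim: "\<And>x. (\<lambda>n. f n x) \<longlonglongrightarrow> l x"
  shows "weak_star_ell1 f l"
proof -
  have B0: "B \<ge> 0" using B[of 0] infsum_nonneg[of UNIV "f 0"] f0 by force
  have l0: "l x \<ge> 0" for x
    by (rule tendsto_lowerbound[OF lim]) (use f0 in auto)
  have ls: "l summable_on UNIV" and lB: "infsum l UNIV \<le> B"
    using nonneg_summable_on_pointwise_limit[OF f0 lim fs B tendsto_const] by auto
  have "(\<lambda>n. \<Sum>\<^sub>\<infinity>x. f n x * h x) \<longlonglongrightarrow> (\<Sum>\<^sub>\<infinity>x. l x * h x)" if h: "h \<in> c0" for h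
  proof (rule LIMSEQ_I)
    fix r :: real assume r: "r > 0"
    define \<epsilon> where "\<epsilon> = r / (3 * (B + 1))"
    have \<epsilon>: "\<epsilon> > 0" "\<epsilon> * B < r / 3"
      using r B0 by (auto simp: \<epsilon>_def field_simps)
    obtain \<phi> where \<phi>: "\<And>k. \<phi> k \<in> finitely_supported" "uniform_limit UNIV \<phi> h sequentially"
      using h unfolding c0_def by blast
    obtain k where k: "\<forall>x\<in>UNIV. dist (\<phi> k x) (h x) < \<epsilon>"
      using uniform_limitD[OF \<phi>(2) \<epsilon>(1)] unfolding eventually_sequentially by blast
    define \<psi> where "\<psi> = \<phi> k"
    have fin: "finite {x. \<psi> x \<noteq> 0}"
      using \<phi>(1)[of k] by (simp add: finitely_supported_def \<psi>_def)
    have \<psi>: "\<bar>h x - \<psi> x\<bar> \<le> \<epsilon>" for x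
      using k[rule_format, of x] by (simp add: \<psi>_def dist_real_def)
    have approx: "\<bar>(\<Sum>\<^sub>\<infinity>x. g x * h x) - (\<Sum>x | \<psi> x \<noteq> 0. g x * \<psi> x)\<bar> < r / 3"
      if "\<And>x. g x \<ge> 0" "g summable_on UNIV" "infsum g UNIV \<le> B" for g
      using infsum_mult_uniform_approx[OF fin \<psi> that(1,2)] mult_left_mono[OF that(3), of \<epsilon>] \<epsilon> by linarith
    have "(\<lambda>n. \<Sum>x | \<psi> x \<noteq> 0. f n x * \<psi> x) \<longlonglongrightarrow> (\<Sum>x | \<psi> x \<noteq> 0. l x * \<psi> x)"
      by (intro tendsto_intros lim)
    then obtain N where N: "\<And>n. n \<ge> N \<Longrightarrow>
        \<bar>(\<Sum>x | \<psi> x \<noteq> 0. f n x * \<psi> x) - (\<Sum>x | \<psi> x \<noteq> 0. l x * \<psi> x)\<bar> < r / 3"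
      using LIMSEQ_D[of "\<lambda>n. \<Sum>x | \<psi> x \<noteq> 0. f n x * \<psi> x" _ "r / 3"] r by auto
    show "\<exists>N. \<forall>n\<ge>N. norm ((\<Sum>\<^sub>\<infinity>x. f n x * h x) - (\<Sum>\<^sub>\<infinity>x. l x * h x)) < r"
    proof (intro exI allI impI)
      fix n assume "n \<ge> N"
      then show "norm ((\<Sum>\<^sub>\<infinity>x. f n x * h x) - (\<Sum>\<^sub>\<infinity>x. l x * h x)) < r"
        using N[of n] approx[OF f0 fs B, of n] approx[OF l0 ls lB]
        unfolding real_norm_def by linarith
    qed
  qed
  then show ?thesis
    using fs ls by (auto simp: weak_star_ell1_def ell_1_iff)
qed

text \<open>
  The mass outside a ball is the total mass minus a finite sum, which converges by pointwise
  convergence. As the radius grows, the finite sums of \<open>l\<close> exhaust its total.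
\<close>

lemma tail_limit_of_total_limit:
  fixes f :: "nat \<Rightarrow> int ^ 'n \<Rightarrow> real"
  assumes fs: "\<And>n. f n summable_on UNIV" and ls: "l summable_on UNIV"
    and lim: "\<And>x. (\<lambda>n. f n x) \<longlonglongrightarrow> l x"
    and tot: "(\<lambda>n. infsum (f n) UNIV) \<longlonglongrightarrow> L"
  shows "tail_limit f (L - infsum l UNIV)"
proof -
  define B where "B R = {i :: int ^ 'n. real (lattice_dist i 0) \<le> R}" for R
  have finB: "finite (B R)" for R
    by (rule finite_subset[OF _ finite_lattice_ball[of "nat \<lceil>R\<rceil>"]]) (auto simp: B_def le_nat_iff, linarith)
  have tail: "(\<Sum>\<^sub>\<infinity>i\<in>{i. real (lattice_dist i 0) > R}. g i) = infsum g UNIV - sum g (B R)"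
    if "g summable_on UNIV" for g :: "int ^ 'n \<Rightarrow> real" and R
  proof -
    have "{i :: int ^ 'n. real (lattice_dist i 0) > R} = UNIV - B R"
      by (auto simp: B_def)
    then show ?thesis
      using that finB infsum_Diff[of g UNIV "B R"] by simp
  qed
  show ?thesis
    unfolding tail_limit_def
  proof (intro exI conjI allI)
    show "(\<lambda>n. \<Sum>\<^sub>\<infinity>i\<in>{i. real (lattice_dist i 0) > R}. f n i) \<longlonglongrightarrow> L - sum l (B R)" for R
      unfolding tail[OF fs] by (intro tendsto_intros tot lim)
    have "(sum l \<longlongrightarrow> infsum l UNIV) (finite_subsets_at_top UNIV)"
      using ls by (rule infsum_tendsto)
    moreover have "filterlim B (finite_subsets_at_top UNIV) at_top"
      unfolding filterlim_finite_subsets_at_top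
    proof safe
      fix F :: "(int ^ 'n) set" assume F: "finite F"
      define R0 where "R0 = (\<Sum>i\<in>F. real (lattice_dist i 0))"
      have "F \<subseteq> B R" if "R \<ge> R0" for R
        using member_le_sum[of _ F "\<lambda>i. real (lattice_dist i 0)"] F that
        by (force simp: B_def R0_def)
      then show "\<forall>\<^sub>F R in at_top. finite (B R) \<and> F \<subseteq> B R \<and> B R \<subseteq> UNIV"
        using finB by (auto simp: eventually_at_top_linorder)
    qed
    ultimately have "((\<lambda>R. sum l (B R)) \<longlongrightarrow> infsum l UNIV) at_top"
      by (rule filterlim_compose)
    then show "((\<lambda>R. L - sum l (B R)) \<longlongrightarrow> L - infsum l UNIV) at_top"
      by (intro tendsto_intros)
  qed
qed

section \<open>The space D1 and its Sobolev constant\<close>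

lemma D1_norm_powr: "p \<noteq> 0 \<Longrightarrow> D1_norm p u powr p = (\<Sum>\<^sub>\<infinity>x. grad_norm p u x powr p)"
  by (simp add: D1_norm_def powr_powr infsum_nonneg)

lemma D1_norm_nonneg [simp]: "D1_norm p u \<ge> 0"
  by (simp add: D1_norm_def)

lemma ell_norm_powr: "q \<noteq> 0 \<Longrightarrow> ell_norm q u powr q = (\<Sum>\<^sub>\<infinity>x. \<bar>u x\<bar> powr q)"
  by (simp add: ell_norm_def powr_powr infsum_nonneg)

lemma grad_norm_powr_diff_le:
  assumes "p > 0"
  shows "grad_norm p (\<lambda>y. u y - w y) x powr p \<le> 2 powr p * (grad_norm p u x powr p + grad_norm p w x powr p)"
proof -
  have "\<bar>(u y - w y) - (u x - w x)\<bar> powr p \<le> 2 powr p * (\<bar>u y - u x\<bar> powr p + \<bar>w y - w x\<bar> powr p)" for y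
    using abs_add_powr_le2[OF assms, of "u y - u x" "w x - w y"]
    by (simp add: algebra_simps abs_minus_commute)
  then have "(\<Sum>y | lattice_adj x y. \<bar>(u y - w y) - (u x - w x)\<bar> powr p)
      \<le> (\<Sum>y | lattice_adj x y. 2 powr p * (\<bar>u y - u x\<bar> powr p + \<bar>w y - w x\<bar> powr p))"
    by (rule sum_mono)
  also have "\<dots> = 2 powr p * ((\<Sum>y | lattice_adj x y. \<bar>u y - u x\<bar> powr p) + (\<Sum>y | lattice_adj x y. \<bar>w y - w x\<bar> powr p))"
    by (simp add: sum_distrib_left sum.distrib distrib_left)
  finally show ?thesis
    using assms by (simp add: grad_norm_powr)
qed

lemma grad_norm_powr_scale:
  assumes "p > 0"
  shows "grad_norm p (\<lambda>y. c * u y) x powr p = \<bar>c\<bar> powr p * grad_norm p u x powr p"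
  using assms by (simp add: grad_norm_powr abs_mult powr_mult sum_distrib_left flip: right_diff_distrib)

lemma tendsto_abs_powr:
  fixes p :: real
  assumes "p > 0" "(f \<longlongrightarrow> a) F"
  shows "((\<lambda>n. \<bar>f n\<bar> powr p) \<longlongrightarrow> \<bar>a\<bar> powr p) F"
  using assms by (intro tendsto_powr' tendsto_rabs) auto

lemma tendsto_grad_norm_powr:
  assumes "p > 0" "\<And>y. ((\<lambda>n. f n y) \<longlongrightarrow> u y) F"
  shows "((\<lambda>n. grad_norm p (f n) x powr p) \<longlongrightarrow> grad_norm p u x powr p) F"
  using assms by (simp add: grad_norm_powr tendsto_sum tendsto_abs_powr tendsto_diff)

text \<open>
  Along an approximating sequence \<open>\<phi> k\<close> the gradient norms stay bounded in terms of that of \<open>u\<close>,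
  and the inequality for \<open>\<phi> k\<close> passes to the pointwise limit by Fatou's lemma. The bound on the
  gradients of \<open>\<phi> k\<close> comes from \<open>grad_norm_powr_diff_le\<close>, which costs the factor \<open>2 powr q\<close> in
  the constant.
\<close>

lemma discrete_sobolev_D1:
  fixes p q :: real
  assumes N: "CARD('n) \<ge> 2" and p: "1 \<le> p" "p < real CARD('n)"
    and q: "q \<ge> real CARD('n) * p / (real CARD('n) - p)"
  obtains C where "C > 0"
    "\<And>u :: int ^ 'n \<Rightarrow> real. u \<in> D1 p \<Longrightarrow>
      (\<lambda>x. grad_norm p u x powr p) summable_on UNIV \<and> u \<in> ell q \<and>
      (\<Sum>\<^sub>\<infinity>x. \<bar>u x\<bar> powr q) \<le> C * (\<Sum>\<^sub>\<infinity>x. grad_norm p u x powr p) powr (q / p)"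
proof -
  have p0: "p > 0" using p by simp
  have "real CARD('n) * p / (real CARD('n) - p) > 0" using p by simp
  with q have q0: "q > 0" by linarith
  obtain C where C: "C > 0" and sob: "\<And>u :: int ^ 'n \<Rightarrow> real. finite {x. u x \<noteq> 0} \<Longrightarrow>
      (\<Sum>\<^sub>\<infinity>x. \<bar>u x\<bar> powr q) \<le> C * (\<Sum>\<^sub>\<infinity>x. grad_norm p u x powr p) powr (q / p)"
    by (rule discrete_sobolev_finitely_supported[OF N p q]) (rule that)
  show ?thesis
  proof (rule that[of "C * 2 powr q"])
    fix u :: "int ^ 'n \<Rightarrow> real" assume "u \<in> D1 p"
    then obtain \<phi> where fin: "\<And>k. finite {x. \<phi> k x \<noteq> 0}" and lim: "\<And>x. (\<lambda>k. \<phi> k x) \<longlonglongrightarrow> u x"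
      and ds: "\<And>k. (\<lambda>x. grad_norm p (\<lambda>y. \<phi> k y - u y) x powr p) summable_on UNIV"
      and d0: "(\<lambda>k. D1_norm p (\<lambda>y. \<phi> k y - u y)) \<longlonglongrightarrow> 0"
      unfolding D1_def finitely_supported_def by blast
    define e where "e k = (\<Sum>\<^sub>\<infinity>x. grad_norm p (\<lambda>y. \<phi> k y - u y) x powr p)" for k
    define E where "E = (\<Sum>\<^sub>\<infinity>x. grad_norm p u x powr p)"
    have E0: "E \<ge> 0" by (simp add: E_def infsum_nonneg)
    have e0: "e \<longlonglongrightarrow> 0"
    proof -
      have "e = (\<lambda>k. \<bar>D1_norm p (\<lambda>y. \<phi> k y - u y)\<bar> powr p)"
        unfolding e_def[abs_def] abs_of_nonneg[OF D1_norm_nonneg] D1_norm_powr[OF less_imp_neq[OF p0, symmetric]] ..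
      moreover have "\<bar>0\<bar> powr p = 0" by simp
      ultimately show ?thesis
        using tendsto_abs_powr[OF p0 d0] by metis
    qed
    have \<phi>s: "(\<lambda>x. grad_norm p (\<phi> k) x powr p) summable_on UNIV" for k
      using grad_norm_powr_has_sum[of p "\<phi> k"] fin p0 by (auto simp: summable_on_def)
    have us: "(\<lambda>x. grad_norm p u x powr p) summable_on UNIV"
    proof (rule summable_on_comparison_test)
      show "(\<lambda>x. 2 powr p * (grad_norm p (\<phi> 0) x powr p + grad_norm p (\<lambda>y. \<phi> 0 y - u y) x powr p)) summable_on UNIV"
        by (intro summable_on_cmult_right summable_on_add \<phi>s ds)
      show "grad_norm p u x powr p \<le> 2 powr p * (grad_norm p (\<phi> 0) x powr p + grad_norm p (\<lambda>y. \<phi> 0 y - u y) x powr p)" for x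
        using grad_norm_powr_diff_le[OF p0, of "\<phi> 0" "\<lambda>y. \<phi> 0 y - u y" x] by simp
    qed simp
    have \<phi>_le: "(\<Sum>\<^sub>\<infinity>x. grad_norm p (\<phi> k) x powr p) \<le> 2 powr p * (E + e k)" for k
    proof -
      have "grad_norm p (\<phi> k) x powr p \<le> 2 powr p * (grad_norm p u x powr p + grad_norm p (\<lambda>y. \<phi> k y - u y) x powr p)" for x
      proof -
        have "grad_norm p (\<lambda>y. u y - \<phi> k y) x powr p = grad_norm p (\<lambda>y. \<phi> k y - u y) x powr p"
          using grad_norm_powr_scale[OF p0, of "-1" "\<lambda>y. \<phi> k y - u y" x] by simp
        then show ?thesis
          using grad_norm_powr_diff_le[OF p0, of u "\<lambda>y. u y - \<phi> k y" x] by simp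
      qed
      moreover have "((\<lambda>x. 2 powr p * (grad_norm p u x powr p + grad_norm p (\<lambda>y. \<phi> k y - u y) x powr p))
          has_sum 2 powr p * (E + e k)) UNIV"
        unfolding E_def e_def by (intro has_sum_cmult_right has_sum_add has_sum_infsum us ds)
      ultimately show ?thesis
        using has_sum_mono[OF has_sum_infsum[OF \<phi>s]] by blast
    qed
    have \<phi>lim: "(\<lambda>k. \<bar>\<phi> k x\<bar> powr q) \<longlonglongrightarrow> \<bar>u x\<bar> powr q" for x
      by (rule tendsto_abs_powr[OF q0 lim])
    have \<phi>q: "(\<lambda>x. \<bar>\<phi> k x\<bar> powr q) summable_on UNIV" for k
      by (rule finite_nonzero_values_imp_summable_on) (simp add: fin)
    have \<phi>b: "(\<Sum>\<^sub>\<infinity>x. \<bar>\<phi> k x\<bar> powr q) \<le> C * \<bar>2 powr p * (E + e k)\<bar> powr (q / p)" for k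
    proof (rule order_trans[OF sob[OF fin]])
      have "(\<Sum>\<^sub>\<infinity>x. grad_norm p (\<phi> k) x powr p) \<ge> 0" by (simp add: infsum_nonneg)
      then show "C * (\<Sum>\<^sub>\<infinity>x. grad_norm p (\<phi> k) x powr p) powr (q / p) \<le> C * \<bar>2 powr p * (E + e k)\<bar> powr (q / p)"
        using \<phi>_le[of k] C p0 q0 by (intro mult_left_mono powr_mono2) auto
    qed
    have blim: "(\<lambda>k. C * \<bar>2 powr p * (E + e k)\<bar> powr (q / p)) \<longlonglongrightarrow> C * \<bar>2 powr p * (E + 0)\<bar> powr (q / p)"
      using p0 q0
      by (intro tendsto_mult[OF tendsto_const] tendsto_abs_powr tendsto_add[OF tendsto_const e0]) simp
    note u_bound = nonneg_summable_on_pointwise_limit[OF powr_ge_zero \<phi>lim \<phi>q \<phi>b blim]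
    have "\<bar>2 powr p * (E + 0)\<bar> powr (q / p) = 2 powr q * E powr (q / p)"
      using E0 p0 by (simp add: powr_mult powr_powr)
    then show "(\<lambda>x. grad_norm p u x powr p) summable_on UNIV \<and> u \<in> ell q \<and>
      (\<Sum>\<^sub>\<infinity>x. \<bar>u x\<bar> powr q) \<le> C * 2 powr q * (\<Sum>\<^sub>\<infinity>x. grad_norm p u x powr p) powr (q / p)"
      using us u_bound by (simp add: ell_def E_def mult.assoc)
  qed (use C in simp)
qed

text \<open>
  The approximations are \<open>\<phi> k = u - t k\<close>, where \<open>t k\<close> is \<open>u\<close> truncated to \<open>[- \<epsilon> k, \<epsilon> k]\<close>. They
  vanish where \<open>\<bar>u\<bar>\<close> is at most \<open>\<epsilon> k\<close>, hence outside a finite set. Truncation does not increase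
  differences, so the gradients of \<open>t k\<close> are dominated by the gradient of \<open>u\<close>, and they tend to
  \<open>0\<close> pointwise.
\<close>

lemma D1_I:
  fixes u :: "int ^ 'n \<Rightarrow> real"
  assumes p: "p > 0" and q: "q > 0" and u: "u \<in> ell q"
    and us: "(\<lambda>x. grad_norm p u x powr p) summable_on UNIV"
  shows "u \<in> D1 p"
proof -
  define \<epsilon> where "\<epsilon> k = inverse (real (Suc k))" for k
  have \<epsilon>0: "\<epsilon> k > 0" for k by (simp add: \<epsilon>_def)
  define t where "t k x = max (- \<epsilon> k) (min (\<epsilon> k) (u x))" for k x
  have t_le: "\<bar>t k x\<bar> \<le> \<epsilon> k" for k x
    using \<epsilon>0[of k] by (auto simp: t_def)
  have t_lim: "(\<lambda>k. t k x) \<longlonglongrightarrow> 0" for x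
    by (rule Lim_null_comparison[of _ \<epsilon>]) (use t_le LIMSEQ_inverse_real_of_nat in \<open>auto simp: \<epsilon>_def[abs_def]\<close>)
  define \<phi> where "\<phi> k x = u x - t k x" for k x
  have lip: "\<bar>(\<phi> k y - u y) - (\<phi> k x - u x)\<bar> \<le> \<bar>u y - u x\<bar>" for k x y
    by (auto simp: \<phi>_def t_def)
  have grad_le: "grad_norm p (\<lambda>y. \<phi> k y - u y) x powr p \<le> grad_norm p u x powr p" for k x
    using p lip by (simp add: grad_norm_powr sum_mono powr_mono2)
  have grad_lim: "(\<lambda>k. grad_norm p (\<lambda>y. \<phi> k y - u y) x powr p) \<longlonglongrightarrow> 0" for x
  proof -
    have "(\<lambda>k. grad_norm p (\<lambda>y. \<phi> k y - u y) x powr p) \<longlonglongrightarrow> grad_norm p (\<lambda>_. 0) x powr p"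
      using tendsto_minus[OF t_lim] by (intro tendsto_grad_norm_powr p) (simp add: \<phi>_def)
    then show ?thesis using p by (simp add: grad_norm_powr)
  qed
  have "\<phi> k \<in> finitely_supported" for k
  proof -
    have "{x. \<phi> k x \<noteq> 0} \<subseteq> {x. \<bar>u x\<bar> powr q \<ge> \<epsilon> k powr q}"
    proof safe
      fix x assume "\<phi> k x \<noteq> 0"
      then have "\<epsilon> k \<le> \<bar>u x\<bar>" by (auto simp: \<phi>_def t_def)
      then show "\<epsilon> k powr q \<le> \<bar>u x\<bar> powr q"
        using \<epsilon>0[of k] q by (intro powr_mono2) auto
    qed
    moreover have "finite {x. \<bar>u x\<bar> powr q \<ge> \<epsilon> k powr q}"
      using u \<epsilon>0[of k] by (intro summable_on_finite_superlevel) (auto simp: ell_def)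
    ultimately show ?thesis
      by (simp add: finitely_supported_def finite_subset)
  qed
  moreover have "(\<lambda>k. \<phi> k x) \<longlonglongrightarrow> u x" for x
    using tendsto_diff[OF tendsto_const t_lim, of "u x"] by (simp add: \<phi>_def)
  moreover have "(\<lambda>x. grad_norm p (\<lambda>y. \<phi> k y - u y) x powr p) summable_on UNIV" for k
    by (rule summable_on_comparison_test[OF us]) (use grad_le in auto)
  moreover have "(\<lambda>k. D1_norm p (\<lambda>y. \<phi> k y - u y)) \<longlonglongrightarrow> 0"
  proof -
    have "(\<lambda>k. \<Sum>\<^sub>\<infinity>x. grad_norm p (\<lambda>y. \<phi> k y - u y) x powr p) \<longlonglongrightarrow> (\<Sum>\<^sub>\<infinity>x :: int ^ 'n. 0)"
      by (rule infsum_dominated_convergence[OF us]) (use grad_le grad_lim in auto)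
    then have "(\<lambda>k. \<bar>\<Sum>\<^sub>\<infinity>x. grad_norm p (\<lambda>y. \<phi> k y - u y) x powr p\<bar> powr (1 / p)) \<longlonglongrightarrow> \<bar>0\<bar> powr (1 / p)"
      using p by (intro tendsto_abs_powr) auto
    then show ?thesis
      by (simp add: D1_norm_def infsum_nonneg)
  qed
  ultimately show ?thesis unfolding D1_def by blast
qed

lemma finitely_supported_in_D1:
  assumes "p > 0" "finite {x. u x \<noteq> 0}"
  shows "u \<in> D1 p"
proof (rule D1_I[OF assms(1), of 1])
  show "u \<in> ell 1"
    unfolding ell_1_iff using assms(2) by (intro finite_nonzero_values_imp_summable_on) simp
  show "(\<lambda>x. grad_norm p u x powr p) summable_on UNIV"
    using assms by (intro has_sum_imp_summable[OF grad_norm_powr_has_sum]) auto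
qed simp

text \<open>
  The infimum is positive by the Sobolev inequality; the unit mass at \<open>0\<close> shows that it is taken
  over a nonempty set. The second part is the definition of \<open>S\<close>, rescaled to functions whose
  \<open>\<ell>\<^sup>q\<close> norm is not \<open>1\<close>.
\<close>

lemma sobolev_constant:
  fixes p q :: real
  assumes N: "CARD('n) \<ge> 2" and p: "1 \<le> p" "p < real CARD('n)"
    and q: "q \<ge> real CARD('n) * p / (real CARD('n) - p)"
  defines "S \<equiv> Inf {D1_norm p w powr p | w :: int ^ 'n \<Rightarrow> real. w \<in> D1 p \<and> ell_norm q w = 1}"
  shows "S > 0"
    and "\<And>w :: int ^ 'n \<Rightarrow> real. w \<in> D1 p \<Longrightarrow>
      S * (\<Sum>\<^sub>\<infinity>x. \<bar>w x\<bar> powr q) powr (p / q) \<le> (\<Sum>\<^sub>\<infinity>x. grad_norm p w x powr p)"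
proof -
  have p0: "p > 0" using p by simp
  have "real CARD('n) * p / (real CARD('n) - p) > 0" using p by simp
  with q have q0: "q > 0" by linarith
  obtain C where C: "C > 0" and sob: "\<And>u :: int ^ 'n \<Rightarrow> real. u \<in> D1 p \<Longrightarrow>
      (\<lambda>x. grad_norm p u x powr p) summable_on UNIV \<and> u \<in> ell q \<and>
      (\<Sum>\<^sub>\<infinity>x. \<bar>u x\<bar> powr q) \<le> C * (\<Sum>\<^sub>\<infinity>x. grad_norm p u x powr p) powr (q / p)"
    by (rule discrete_sobolev_D1[OF N p q]) (rule that)
  define V where "V = {D1_norm p w powr p | w :: int ^ 'n \<Rightarrow> real. w \<in> D1 p \<and> ell_norm q w = 1}"
  have norm1: "ell_norm q w = 1 \<longleftrightarrow> (\<Sum>\<^sub>\<infinity>x. \<bar>w x\<bar> powr q) = 1" for w :: "int ^ 'n \<Rightarrow> real"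
  proof
    assume "ell_norm q w = 1"
    then show "(\<Sum>\<^sub>\<infinity>x. \<bar>w x\<bar> powr q) = 1"
      using ell_norm_powr[of q w] q0 by simp
  qed (simp add: ell_norm_def)
  define \<delta> where "\<delta> x = (if x = (0 :: int ^ 'n) then 1 else 0 :: real)" for x
  have "((\<lambda>x. \<bar>\<delta> x\<bar> powr q) has_sum (\<Sum>x\<in>{0}. \<bar>\<delta> x\<bar> powr q)) UNIV"
    by (rule has_sum_finite_neutralI[of "{0}"]) (auto simp: \<delta>_def)
  from infsumI[OF this] have "(\<Sum>\<^sub>\<infinity>x. \<bar>\<delta> x\<bar> powr q) = 1"
    by (simp add: \<delta>_def)
  moreover have "\<delta> \<in> D1 p"
    using p0 by (intro finitely_supported_in_D1) (auto simp: \<delta>_def)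
  ultimately have "V \<noteq> {}" using norm1 by (auto simp: V_def)
  moreover have "(1 / C) powr (p / q) \<le> z" if "z \<in> V" for z
  proof -
    obtain w :: "int ^ 'n \<Rightarrow> real" where w: "w \<in> D1 p" "(\<Sum>\<^sub>\<infinity>x. \<bar>w x\<bar> powr q) = 1" "z = (\<Sum>\<^sub>\<infinity>x. grad_norm p w x powr p)"
      using \<open>z \<in> V\<close> p0 by (auto simp: V_def norm1 D1_norm_powr)
    then have "z \<ge> 0" by (simp add: infsum_nonneg)
    have "1 / C \<le> z powr (q / p)"
      using sob[OF w(1)] w C by (simp add: field_simps)
    then have "(1 / C) powr (p / q) \<le> (z powr (q / p)) powr (p / q)"
      using C p0 q0 by (intro powr_mono2) auto
    then show ?thesis
      using \<open>z \<ge> 0\<close> p0 q0 by (simp add: powr_powr)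
  qed
  ultimately have "(1 / C) powr (p / q) \<le> S"
    unfolding S_def V_def[symmetric] by (rule cInf_greatest)
  moreover have "(1 / C) powr (p / q) > 0" using C by simp
  ultimately show "S > 0" by linarith
  fix w :: "int ^ 'n \<Rightarrow> real" assume w: "w \<in> D1 p"
  define X where "X = (\<Sum>\<^sub>\<infinity>x. \<bar>w x\<bar> powr q)"
  define E where "E = (\<Sum>\<^sub>\<infinity>x. grad_norm p w x powr p)"
  have X0: "X \<ge> 0" and E0: "E \<ge> 0" by (simp_all add: X_def E_def infsum_nonneg)
  show "S * X powr (p / q) \<le> E"
  proof (cases "X = 0")
    case False
    with X0 have X: "X > 0" by simp
    define c where "c = X powr (- 1 / q)"
    define w' where "w' x = c * w x" for x
    have c0: "c > 0" using X by (simp add: c_def)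
    have cq: "\<bar>c\<bar> powr r = inverse (X powr (r / q))" for r
    proof -
      have "c powr r = X powr (- (r / q))"
        unfolding c_def powr_powr by simp
      then show ?thesis using c0 by (simp add: powr_minus)
    qed
    have ws: "(\<lambda>x. \<bar>w x\<bar> powr q) summable_on UNIV" "(\<lambda>x. grad_norm p w x powr p) summable_on UNIV"
      using sob[OF w] by (auto simp: ell_def)
    have "(\<Sum>\<^sub>\<infinity>x. \<bar>w' x\<bar> powr q) = \<bar>c\<bar> powr q * X"
      unfolding X_def w'_def abs_mult powr_mult by (rule infsum_cmult_right')
    also have "\<dots> = 1"
      unfolding cq using X q0 by simp
    finally have n1: "ell_norm q w' = 1" by (simp add: norm1)
    have gw: "grad_norm p w' x powr p = \<bar>c\<bar> powr p * grad_norm p w x powr p" for x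
      unfolding w'_def by (rule grad_norm_powr_scale[OF p0])
    have "w' \<in> D1 p"
    proof (rule D1_I[OF p0 q0])
      show "w' \<in> ell q"
        using ws(1) by (simp add: ell_def w'_def abs_mult powr_mult summable_on_cmult_right)
      show "(\<lambda>x. grad_norm p w' x powr p) summable_on UNIV"
        unfolding gw by (rule summable_on_cmult_right[OF ws(2)])
    qed
    with n1 have "D1_norm p w' powr p \<in> V" by (auto simp: V_def)
    then have "S \<le> D1_norm p w' powr p"
      unfolding S_def V_def[symmetric]
      by (rule cInf_lower) (auto simp: V_def intro: bdd_belowI[of _ 0])
    also have "\<dots> = \<bar>c\<bar> powr p * E"
      unfolding D1_norm_powr[OF less_imp_neq[OF p0, symmetric]] gw E_def by (rule infsum_cmult_right')
    also have "\<dots> = E / X powr (p / q)"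
      unfolding cq by (simp add: field_simps)
    finally show ?thesis
      using X by (simp add: field_simps)
  qed (use E0 in simp)
qed

section \<open>Concentration compactness\<close>

theorem lemma12:
  fixes p q S :: real and v :: "nat \<Rightarrow> int ^ 'n \<Rightarrow> real"
  assumes "CARD('n) \<ge> 3"
    and "1 \<le> p" and "p < real CARD('n)"
    and "q \<ge> real CARD('n) * p / (real CARD('n) - p)"
    and "S = Inf {D1_norm p w powr p | w :: int ^ 'n \<Rightarrow> real. w \<in> D1 p \<and> ell_norm q w = 1}"
    and "\<forall>n. v n \<in> D1 p"
    and "\<exists>C. \<forall>n. D1_norm p (v n) \<le> C"
  shows "\<exists>(r :: nat \<Rightarrow> nat) (u :: int ^ 'n \<Rightarrow> real) (\<mu> :: real) (\<nu> :: real).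
      strict_mono r \<and>
      (\<forall>x. (\<lambda>n. v (r n) x) \<longlonglongrightarrow> u x) \<and>
      weak_star_ell1 (\<lambda>n x. grad_norm p (v (r n)) x powr p) (\<lambda>x. grad_norm p u x powr p) \<and>
      (\<forall>n. v (r n) \<in> ell q) \<and> u \<in> ell q \<and>
      tail_limit (\<lambda>n x. grad_norm p (v (r n)) x powr p) \<mu> \<and>
      tail_limit (\<lambda>n x. \<bar>v (r n) x\<bar> powr q) \<nu> \<and>
      weak_star_ell1 (\<lambda>n x. grad_norm p (\<lambda>y. v (r n) y - u y) x powr p) (\<lambda>x. 0) \<and>
      weak_star_ell1 (\<lambda>n x. \<bar>v (r n) x - u x\<bar> powr q) (\<lambda>x. 0) \<and>
      \<nu> powr (p / q) \<le> inverse S * \<mu> \<and>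
      (\<lambda>n. D1_norm p (v (r n)) powr p) \<longlonglongrightarrow> D1_norm p u powr p + \<mu> \<and>
      (\<lambda>n. ell_norm q (v (r n)) powr q) \<longlonglongrightarrow> ell_norm q u powr q + \<nu>"
proof -
  have N: "CARD('n) \<ge> 2" using assms(1) by simp
  have p0: "p > 0" using assms(2) by simp
  have "real CARD('n) * p / (real CARD('n) - p) > 0" using assms(2,3) by simp
  with assms(4) have q0: "q > 0" by linarith
  note S_pos = sobolev_constant(1)[OF N assms(2-4), folded assms(5)]
  note S_le = sobolev_constant(2)[OF N assms(2-4), folded assms(5)]
  obtain C where C: "C > 0" and sob: "\<And>u :: int ^ 'n \<Rightarrow> real. u \<in> D1 p \<Longrightarrow>
      (\<lambda>x. grad_norm p u x powr p) summable_on UNIV \<and> u \<in> ell q \<and>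
      (\<Sum>\<^sub>\<infinity>x. \<bar>u x\<bar> powr q) \<le> C * (\<Sum>\<^sub>\<infinity>x. grad_norm p u x powr p) powr (q / p)"
    by (rule discrete_sobolev_D1[OF N assms(2-4)]) (rule that)
  have vD: "v n \<in> D1 p" for n using assms(6) by blast
  have Gs: "(\<lambda>x. grad_norm p (v n) x powr p) summable_on UNIV"
    and Vs: "(\<lambda>x. \<bar>v n x\<bar> powr q) summable_on UNIV" for n
    using sob[OF vD] by (auto simp: ell_def)
  define G where "G n = (\<Sum>\<^sub>\<infinity>x. grad_norm p (v n) x powr p)" for n
  define V where "V n = (\<Sum>\<^sub>\<infinity>x. \<bar>v n x\<bar> powr q)" for n
  obtain K where K: "\<And>n. D1_norm p (v n) \<le> K" using assms(7) by blast
  define A where "A = K powr p"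
  define B where "B = C * A powr (q / p)"
  have G0: "G n \<ge> 0" and V0: "V n \<ge> 0" for n
    by (simp_all add: G_def V_def infsum_nonneg)
  have GA: "G n \<le> A" for n
    using K[of n] p0 unfolding G_def A_def D1_norm_powr[OF less_imp_neq[OF p0, symmetric], symmetric]
    by (intro powr_mono2) auto
  have VB: "V n \<le> B" for n
  proof -
    have "V n \<le> C * G n powr (q / p)"
      using sob[OF vD] by (simp add: V_def G_def)
    also have "\<dots> \<le> B"
      unfolding B_def using C GA G0 p0 q0 by (intro mult_left_mono powr_mono2) auto
    finally show ?thesis .
  qed
  have v_le: "\<bar>v n x\<bar> \<le> B powr (1 / q)" for n x
  proof -
    have "\<bar>v n x\<bar> powr q \<le> V n"
      using finite_sum_le_infsum[OF Vs, of "{x}" n] by (simp add: V_def)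
    with VB[of n] have "\<bar>v n x\<bar> powr q \<le> B" by linarith
    then have "(\<bar>v n x\<bar> powr q) powr (1 / q) \<le> B powr (1 / q)"
      using q0 by (intro powr_mono2) auto
    then show ?thesis using q0 by (simp add: powr_powr)
  qed
  \<comment> \<open>the values of \<open>v n\<close> and its two masses together, for one diagonal extraction\<close>
  define f where "f n z = (case z of Inl x \<Rightarrow> v n x | Inr b \<Rightarrow> if b then G n else V n)" for n and z :: "int ^ 'n + bool"
  have "norm (f n z) \<le> max (B powr (1 / q)) (max A B)" for n z
    using v_le GA VB G0 V0 by (auto simp: f_def le_max_iff_disj split: sum.split)
  then obtain r where r: "strict_mono (r :: nat \<Rightarrow> nat)" and conv: "\<And>z. \<exists>l. (\<lambda>n. f (r n) z) \<longlonglongrightarrow> l"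
    using function_convergent_subsequence[of UNIV f "max (B powr (1 / q)) (max A B)"]
    by (metis UNIV_I countableI_type)
  obtain u where u: "\<And>x. (\<lambda>n. v (r n) x) \<longlonglongrightarrow> u x"
    using conv[of "Inl _"] by (simp add: f_def) metis
  obtain LG where LG: "(\<lambda>n. G (r n)) \<longlonglongrightarrow> LG"
    using conv[of "Inr True"] by (auto simp: f_def)
  obtain LV where LV: "(\<lambda>n. V (r n)) \<longlonglongrightarrow> LV"
    using conv[of "Inr False"] by (auto simp: f_def)
  have glim: "(\<lambda>n. grad_norm p (v (r n)) x powr p) \<longlonglongrightarrow> grad_norm p u x powr p" for x
    by (rule tendsto_grad_norm_powr[OF p0 u])
  have vlim: "(\<lambda>n. \<bar>v (r n) x\<bar> powr q) \<longlonglongrightarrow> \<bar>u x\<bar> powr q" for x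
    by (rule tendsto_abs_powr[OF q0 u])
  have Gu: "(\<lambda>x. grad_norm p u x powr p) summable_on UNIV"
    and GuA: "(\<Sum>\<^sub>\<infinity>x. grad_norm p u x powr p) \<le> A"
    using nonneg_summable_on_pointwise_limit[OF _ glim Gs, of "\<lambda>_. A" A] GA by (simp_all add: G_def)
  have Vu: "(\<lambda>x. \<bar>u x\<bar> powr q) summable_on UNIV"
    and VuB: "(\<Sum>\<^sub>\<infinity>x. \<bar>u x\<bar> powr q) \<le> B"
    using nonneg_summable_on_pointwise_limit[OF _ vlim Vs, of "\<lambda>_. B" B] VB by (simp_all add: V_def)
  define \<mu> where "\<mu> = LG - (\<Sum>\<^sub>\<infinity>x. grad_norm p u x powr p)"
  define \<nu> where "\<nu> = LV - (\<Sum>\<^sub>\<infinity>x. \<bar>u x\<bar> powr q)"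
  define d where "d n y = v (r n) y - u y" for n y
  have d_lim: "(\<lambda>n. d n x) \<longlonglongrightarrow> 0" for x
    using tendsto_diff[OF u tendsto_const, of x "u x"] by (simp add: d_def)
  have gd_lim: "(\<lambda>n. grad_norm p (d n) x powr p) \<longlonglongrightarrow> 0" for x
    using tendsto_grad_norm_powr[OF p0 d_lim, where x = x] p0 by (simp add: grad_norm_powr[of p "\<lambda>_. 0"])
  have vd_lim: "(\<lambda>n. \<bar>d n x\<bar> powr q) \<longlonglongrightarrow> 0" for x
    using tendsto_abs_powr[OF q0 d_lim, of x] q0 by simp
  have Gd: "(\<lambda>x. grad_norm p (d n) x powr p) summable_on UNIV
      \<and> (\<Sum>\<^sub>\<infinity>x. grad_norm p (d n) x powr p) \<le> 2 powr p * (A + A)" for n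
  proof -
    have hs: "((\<lambda>x. 2 powr p * (grad_norm p (v (r n)) x powr p + grad_norm p u x powr p)) has_sum
        2 powr p * (G (r n) + (\<Sum>\<^sub>\<infinity>x. grad_norm p u x powr p))) UNIV"
      unfolding G_def by (intro has_sum_cmult_right has_sum_add has_sum_infsum Gs Gu)
    have le: "grad_norm p (d n) x powr p \<le> 2 powr p * (grad_norm p (v (r n)) x powr p + grad_norm p u x powr p)" for x
      using grad_norm_powr_diff_le[OF p0, of "v (r n)" u x] by (simp add: d_def[abs_def])
    have s: "(\<lambda>x. grad_norm p (d n) x powr p) summable_on UNIV"
      by (rule summable_on_comparison_test[OF has_sum_imp_summable[OF hs]]) (use le in auto)
    have "(\<Sum>\<^sub>\<infinity>x. grad_norm p (d n) x powr p) \<le> 2 powr p * (G (r n) + (\<Sum>\<^sub>\<infinity>x. grad_norm p u x powr p))"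
      by (rule has_sum_mono[OF has_sum_infsum[OF s] hs le])
    also have "\<dots> \<le> 2 powr p * (A + A)"
      by (intro mult_left_mono add_mono GA GuA) auto
    finally show ?thesis using s by blast
  qed
  have Vd: "(\<lambda>x. \<bar>d n x\<bar> powr q) summable_on UNIV
      \<and> (\<Sum>\<^sub>\<infinity>x. \<bar>d n x\<bar> powr q) \<le> 2 powr q * (B + B)" for n
  proof -
    have hs: "((\<lambda>x. 2 powr q * (\<bar>v (r n) x\<bar> powr q + \<bar>u x\<bar> powr q)) has_sum
        2 powr q * (V (r n) + (\<Sum>\<^sub>\<infinity>x. \<bar>u x\<bar> powr q))) UNIV"
      unfolding V_def by (intro has_sum_cmult_right has_sum_add has_sum_infsum Vs Vu)
    have le: "\<bar>d n x\<bar> powr q \<le> 2 powr q * (\<bar>v (r n) x\<bar> powr q + \<bar>u x\<bar> powr q)" for x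
      using abs_add_powr_le2[OF q0, of "v (r n) x" "- u x"] by (simp add: d_def)
    have s: "(\<lambda>x. \<bar>d n x\<bar> powr q) summable_on UNIV"
      by (rule summable_on_comparison_test[OF has_sum_imp_summable[OF hs]]) (use le in auto)
    have "(\<Sum>\<^sub>\<infinity>x. \<bar>d n x\<bar> powr q) \<le> 2 powr q * (V (r n) + (\<Sum>\<^sub>\<infinity>x. \<bar>u x\<bar> powr q))"
      by (rule has_sum_mono[OF has_sum_infsum[OF s] hs le])
    also have "\<dots> \<le> 2 powr q * (B + B)"
      by (intro mult_left_mono add_mono VB VuB) auto
    finally show ?thesis using s by blast
  qed
  \<comment> \<open>this is what makes the Sobolev inequality with constant \<open>S\<close> available for the differences\<close>
  have dD: "d n \<in> D1 p" for n
    using Gd Vd by (intro D1_I[OF p0 q0]) (auto simp: ell_def)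
  \<comment> \<open>by the splitting, the differences carry exactly the mass missing in the limit\<close>
  have "(\<lambda>n. G (r n) - (\<Sum>\<^sub>\<infinity>x. grad_norm p (d n) x powr p)) \<longlonglongrightarrow> (\<Sum>\<^sub>\<infinity>x. grad_norm p u x powr p)"
    unfolding G_def
  proof (rule brezis_lieb_infsum[where B = "2 powr p * (A + A)"])
    fix \<epsilon> :: real assume "\<epsilon> > 0"
    then show "\<exists>C. \<forall>n x. \<bar>grad_norm p (v (r n)) x powr p - grad_norm p (d n) x powr p\<bar>
        \<le> \<epsilon> * grad_norm p (d n) x powr p + C * grad_norm p u x powr p"
      using grad_norm_powr_split[OF p0, of \<epsilon>] unfolding d_def[abs_def] by blast
  qed (use Gu Gs Gd glim gd_lim in auto)
  then have Gd_lim: "(\<lambda>n. \<Sum>\<^sub>\<infinity>x. grad_norm p (d n) x powr p) \<longlonglongrightarrow> \<mu>"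
    using tendsto_diff[OF LG] by (fastforce simp: \<mu>_def)
  have "(\<lambda>n. V (r n) - (\<Sum>\<^sub>\<infinity>x. \<bar>d n x\<bar> powr q)) \<longlonglongrightarrow> (\<Sum>\<^sub>\<infinity>x. \<bar>u x\<bar> powr q)"
    unfolding V_def
  proof (rule brezis_lieb_infsum[where B = "2 powr q * (B + B)"])
    fix \<epsilon> :: real assume "\<epsilon> > 0"
    then show "\<exists>C. \<forall>n x. \<bar>\<bar>v (r n) x\<bar> powr q - \<bar>d n x\<bar> powr q\<bar> \<le> \<epsilon> * \<bar>d n x\<bar> powr q + C * \<bar>u x\<bar> powr q"
      using abs_powr_split[OF q0, of \<epsilon>] unfolding d_def by blast
  qed (use Vu Vs Vd vlim vd_lim in auto)
  then have Vd_lim: "(\<lambda>n. \<Sum>\<^sub>\<infinity>x. \<bar>d n x\<bar> powr q) \<longlonglongrightarrow> \<nu>"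
    using tendsto_diff[OF LV] by (fastforce simp: \<nu>_def)
  have \<nu>0: "\<nu> \<ge> 0"
    by (rule tendsto_lowerbound[OF Vd_lim]) (auto simp: infsum_nonneg)
  have "S * \<nu> powr (p / q) \<le> \<mu>"
  proof (rule LIMSEQ_le[OF _ Gd_lim])
    show "(\<lambda>n. S * (\<Sum>\<^sub>\<infinity>x. \<bar>d n x\<bar> powr q) powr (p / q)) \<longlonglongrightarrow> S * \<nu> powr (p / q)"
      using p0 q0 by (intro tendsto_intros tendsto_powr' Vd_lim) (auto simp: infsum_nonneg)
  qed (use S_le[OF dD] in blast)
  then have "\<nu> powr (p / q) \<le> inverse S * \<mu>"
    using S_pos by (simp add: field_simps)
  moreover have "tail_limit (\<lambda>n x. grad_norm p (v (r n)) x powr p) \<mu>"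
    unfolding \<mu>_def using LG by (intro tail_limit_of_total_limit Gs Gu glim) (simp add: G_def)
  moreover have "tail_limit (\<lambda>n x. \<bar>v (r n) x\<bar> powr q) \<nu>"
    unfolding \<nu>_def using LV by (intro tail_limit_of_total_limit Vs Vu vlim) (simp add: V_def)
  moreover have "weak_star_ell1 (\<lambda>n x. grad_norm p (v (r n)) x powr p) (\<lambda>x. grad_norm p u x powr p)"
    using GA by (intro weak_star_ell1_nonneg_bounded[where B = A] Gs glim) (auto simp: G_def)
  moreover have "weak_star_ell1 (\<lambda>n x. grad_norm p (\<lambda>y. v (r n) y - u y) x powr p) (\<lambda>x. 0)"
    using Gd gd_lim unfolding d_def[abs_def]
    by (intro weak_star_ell1_nonneg_bounded[where B = "2 powr p * (A + A)"]) auto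
  moreover have "weak_star_ell1 (\<lambda>n x. \<bar>v (r n) x - u x\<bar> powr q) (\<lambda>x. 0)"
    using Vd vd_lim unfolding d_def
    by (intro weak_star_ell1_nonneg_bounded[where B = "2 powr q * (B + B)"]) auto
  moreover have "(\<lambda>n. D1_norm p (v (r n)) powr p) \<longlonglongrightarrow> D1_norm p u powr p + \<mu>"
    using LG p0 by (simp add: D1_norm_powr \<mu>_def G_def)
  moreover have "(\<lambda>n. ell_norm q (v (r n)) powr q) \<longlonglongrightarrow> ell_norm q u powr q + \<nu>"
    using LV q0 by (simp add: ell_norm_powr \<nu>_def V_def)
  moreover have "\<forall>n. v (r n) \<in> ell q" "u \<in> ell q"
    using Vs Vu by (auto simp: ell_def)
  ultimately show ?thesis
    using r u by blast
qed

end
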